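(* Let $(a_n)_{n\in\mathbb{N}}$ and $(b_{n,j})_{n,j\in\mathbb{N}}$ be real numbers with $a_n\ge 0$ for all $n$, $b_{n,j}\ge 0$ for all $n,j$, and $b_{n,j}=0$ whenever $n\ge j$. Let $w=(w_n)_{n=1}^\infty$ be a weight such that $w_n\ge n$ for all $n\in\mathbb{N}$ and such that there exists $\kappa\in(0,1]$ with $\sum_{n=1}^{j-1}w_nb_{n,j}\le\kappa w_j$ for all $j=2,3,\ldots$. Then $G^{(w)}=\overline{A^{(w)}+B^{(w)}}$ is the generator of a substochastic $C_0$-semigroup $(S^{(w)}(t))_{t\ge0}$ on $\ell_w^1$. Moreover, for any sequence $(c_n)_{n=1}^\infty$ with $c_n\le c_{n+1}$ and $a_n\le c_n$ for all $n\in\mathbb{N}$, the semigroup $(S^{(w)}(t))_{t\ge0}$ leaves invariant the subspace $\mathcal{D}(C^{(w)})=\ell^1_{\widetilde w}$, where $\widetilde w_n=w_n+w_nc_n$, $n\in\mathbb{N}$. If, in addition, $a_1=0$ and $\sum_{n=1}^{j-1}nb_{n,j}=j$ for all $j=2,3,\ldots$, and $w_n=n$ for all $n\in\mathbb{N}$, then the semigroup $(S_1(t))_{t\ge0}$ generated by $G_1=\overline{A_1+B_1}$ is stochastic on $X_{[1]}$.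
   Context: $\mathbb{N}=\{1,2,\ldots\}$. A weight is a sequence $w=(w_n)_{n=1}^\infty$ of strictly positive reals, and $\ell_w^1$ is the Banach space of real sequences $f=(f_n)_{n=1}^\infty$ with $\|f\|_w=\sum_{n=1}^\infty w_n|f_n|<\infty$. It is ordered componentwise, with positive cone $(\ell_w^1)_+=\{f\in\ell_w^1: f_n\ge0\ \forall n\}$. Operators: $A^{(w)}f=(-a_nf_n)_{n=1}^\infty$ with $\mathcal{D}(A^{(w)})=\{f\in\ell_w^1:(a_nf_n)_n\in\ell_w^1\}$; $B^{(w)}f=\bigl(\sum_{j=n+1}^\infty a_jb_{n,j}f_j\bigr)_{n=1}^\infty$ with $\mathcal{D}(B^{(w)})$ the set of $f\in\ell_w^1$ for which this sequence is well defined and lies in $\ell_w^1$; $A^{(w)}+B^{(w)}$ has domain $\mathcal{D}(A^{(w)})\cap\mathcal{D}(B^{(w)})$, and the overline denotes the closure of an operator. $C^{(w)}$ is the multiplication operator $[C^{(w)}f]_n=-c_nf_n$ with $\mathcal{D}(C^{(w)})=\{f\in\ell_w^1:\sum_{n=1}^\infty w_nc_n|f_n|<\infty\}$. For $w_n=n$ ($n\in\mathbb{N}$), $\ell_w^1$ is denoted $X_{[1]}$ and $A^{(w)},B^{(w)}$ are denoted $A_1,B_1$. A $C_0$-semigroup $(S(t))_{t\ge0}$ is positive if each $S(t)$ maps the positive cone into itself; it is substochastic (resp. stochastic) if it is positive and $\|S(t)f\|\le\|f\|$ (resp. $\|S(t)f\|=\|f\|$) for all $t\ge 0$ and all $f$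 in the positive cone. *)

theory Defs
  imports "HOL-Analysis.Analysis"
begin

text \<open>
  A sequence \<open>(f\<^sub>n)\<close> with \<open>n = 1, 2, \<dots>\<close> is a function \<open>nat \<Rightarrow> real\<close>. The space \<open>ell1 w\<close>
  contains only functions vanishing at the unused index \<open>0\<close>, so that equality of its elements is
  equality of sequences. Weights and coefficients are unconstrained at index \<open>0\<close>, and no definition
  below depends on their values there.
\<close>

type_synonym seq = "nat \<Rightarrow> real"

definition weight :: "seq \<Rightarrow> bool" where
  "weight w \<longleftrightarrow> (\<forall>n\<ge>1. 0 < w n)"

definition ell1 :: "seq \<Rightarrow> seq set" where
  "ell1 w = {f. f 0 = 0 \<and> summable (\<lambda>n. w (Suc n) * \<bar>f (Suc n)\<bar>)}"

definition wnorm :: "seq \<Rightarrow> seq \<Rightarrow> real" where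
  "wnorm w f = (\<Sum>n. w (Suc n) * \<bar>f (Suc n)\<bar>)"

definition pos_cone :: "seq \<Rightarrow> seq set" where
  "pos_cone w = {f \<in> ell1 w. \<forall>n. 0 \<le> f n}"

text \<open>
  Unbounded operators are represented by their graphs; the domain of an operator \<open>T\<close> is
  \<open>Domain T\<close>.
\<close>

type_synonym seq_op = "(seq \<times> seq) set"

definition op_A :: "seq \<Rightarrow> seq \<Rightarrow> seq_op" where
  "op_A w a = {(f, \<lambda>n. - a n * f n) | f. f \<in> ell1 w \<and> (\<lambda>n. a n * f n) \<in> ell1 w}"

definition B_map :: "seq \<Rightarrow> (nat \<Rightarrow> nat \<Rightarrow> real) \<Rightarrow> seq \<Rightarrow> seq" where
  "B_map a b f = (\<lambda>n. if n = 0 then 0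
                      else (\<Sum>k. a (n + 1 + k) * b n (n + 1 + k) * f (n + 1 + k)))"

definition op_B :: "seq \<Rightarrow> seq \<Rightarrow> (nat \<Rightarrow> nat \<Rightarrow> real) \<Rightarrow> seq_op" where
  "op_B w a b = {(f, B_map a b f) | f. f \<in> ell1 w \<and>
     (\<forall>n\<ge>1. summable (\<lambda>k. a (n + 1 + k) * b n (n + 1 + k) * f (n + 1 + k))) \<and>
     B_map a b f \<in> ell1 w}"

definition op_C :: "seq \<Rightarrow> seq \<Rightarrow> seq_op" where
  "op_C w c = {(f, \<lambda>n. - c n * f n) | f. f \<in> ell1 w \<and>
     summable (\<lambda>n. w (Suc n) * c (Suc n) * \<bar>f (Suc n)\<bar>)}"

definition op_plus :: "seq_op \<Rightarrow> seq_op \<Rightarrow> seq_op" where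
  "op_plus T U = {(f, \<lambda>n. g n + h n) | f g h. (f, g) \<in> T \<and> (f, h) \<in> U}"

text \<open>
  The closure of the graph in \<open>ell1 w \<times> ell1 w\<close>. It is again the graph of an operator exactly when
  \<open>T\<close> is closable, which holds in particular whenever \<open>op_closure w T\<close> equals a (single-valued)
  semigroup generator.
\<close>

definition op_closure :: "seq \<Rightarrow> seq_op \<Rightarrow> seq_op" where
  "op_closure w T = {(f, g). f \<in> ell1 w \<and> g \<in> ell1 w \<and>
     (\<exists>u v. (\<forall>k::nat. (u k, v k) \<in> T) \<and>
        (\<lambda>k. wnorm w (\<lambda>n. u k n - f n)) \<longlonglongrightarrow> 0 \<and>
        (\<lambda>k. wnorm w (\<lambda>n. v k n - g n)) \<longlonglongrightarrow> 0)}"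

definition bounded_linear_on_ell1 :: "seq \<Rightarrow> (seq \<Rightarrow> seq) \<Rightarrow> bool" where
  "bounded_linear_on_ell1 w T \<longleftrightarrow>
     (\<forall>f\<in>ell1 w. T f \<in> ell1 w) \<and>
     (\<forall>f\<in>ell1 w. \<forall>g\<in>ell1 w. T (\<lambda>n. f n + g n) = (\<lambda>n. T f n + T g n)) \<and>
     (\<forall>r. \<forall>f\<in>ell1 w. T (\<lambda>n. r * f n) = (\<lambda>n. r * T f n)) \<and>
     (\<exists>M. \<forall>f\<in>ell1 w. wnorm w (T f) \<le> M * wnorm w f)"

text \<open>Only the values \<open>S t f\<close> with \<open>t \<ge> 0\<close> and \<open>f \<in> ell1 w\<close> are relevant.\<close>

definition C0_semigroup :: "seq \<Rightarrow> (real \<Rightarrow> seq \<Rightarrow> seq) \<Rightarrow> bool" where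
  "C0_semigroup w S \<longleftrightarrow>
     (\<forall>t\<ge>0. bounded_linear_on_ell1 w (S t)) \<and>
     (\<forall>f\<in>ell1 w. S 0 f = f) \<and>
     (\<forall>s\<ge>0. \<forall>t\<ge>0. \<forall>f\<in>ell1 w. S (s + t) f = S s (S t f)) \<and>
     (\<forall>f\<in>ell1 w. ((\<lambda>t. wnorm w (\<lambda>n. S t f n - f n)) \<longlongrightarrow> 0) (at_right 0))"

definition generator :: "seq \<Rightarrow> (real \<Rightarrow> seq \<Rightarrow> seq) \<Rightarrow> seq_op" where
  "generator w S = {(f, g). f \<in> ell1 w \<and> g \<in> ell1 w \<and>
     ((\<lambda>h. wnorm w (\<lambda>n. (S h f n - f n) / h - g n)) \<longlongrightarrow> 0) (at_right 0)}"

definition positive_semigroup :: "seq \<Rightarrow> (real \<Rightarrow> seq \<Rightarrow> seq) \<Rightarrow> bool" where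
  "positive_semigroup w S \<longleftrightarrow>
     C0_semigroup w S \<and> (\<forall>t\<ge>0. \<forall>f\<in>pos_cone w. S t f \<in> pos_cone w)"

definition substochastic_semigroup :: "seq \<Rightarrow> (real \<Rightarrow> seq \<Rightarrow> seq) \<Rightarrow> bool" where
  "substochastic_semigroup w S \<longleftrightarrow>
     positive_semigroup w S \<and> (\<forall>t\<ge>0. \<forall>f\<in>pos_cone w. wnorm w (S t f) \<le> wnorm w f)"

definition stochastic_semigroup :: "seq \<Rightarrow> (real \<Rightarrow> seq \<Rightarrow> seq) \<Rightarrow> bool" where
  "stochastic_semigroup w S \<longleftrightarrow>
     positive_semigroup w S \<and> (\<forall>t\<ge>0. \<forall>f\<in>pos_cone w. wnorm w (S t f) = wnorm w f)"

definition op_G :: "seq \<Rightarrow> seq \<Rightarrow> (nat \<Rightarrow> nat \<Rightarrow> real) \<Rightarrow> seq_op" where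
  "op_G w a b = op_closure w (op_plus (op_A w a) (op_B w a b))"

end

theory Submission
  imports Defs
begin

text \<open>
  Since \<open>b n j\<close> vanishes for \<open>j \<le> n\<close>, the operator \<open>L = A + B\<close> is upper triangular and leaves the
  sequences supported in \<open>{1..N}\<close> invariant, so the columns \<open>p t n j\<close> of \<open>exp (t L)\<close> are given by
  finite-dimensional linear systems. They are nonnegative, and
  \<open>(\<Sum>n. v n * p t n j) \<le> v j\<close> for every weight \<open>v\<close> with \<open>(\<Sum>n<j. v n * b n j) \<le> v j\<close>. Hence the
  matrix \<open>p t\<close> acts as a contraction semigroup on each such space simultaneously; applying this to
  \<open>w\<close> and to \<open>w + w c\<close> gives the semigroup and the invariance of the domain of \<open>C\<close>. The generator is
  the closure of \<open>L\<close> on finitely supported sequences, because there \<open>1 - L\<close> is onto (back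
  substitution) and the generator is dissipative; truncation shows that \<open>A + B\<close> has the same closure.
\<close>

section \<open>Weighted sequence spaces\<close>

lemma sum_Suc_conv: "(\<Sum>n<N. f (Suc n)) = (\<Sum>n=1..N. f n)" for f :: "nat \<Rightarrow> real"
  by (simp add: sum.atLeast1_atMost_eq)

section \<open>Truncation, finite support and infinite matrices\<close>

definition trunc :: "nat \<Rightarrow> seq \<Rightarrow> seq" where
  "trunc N f = (\<lambda>n. if n \<le> N then f n else 0)"

definition supp_upto :: "nat \<Rightarrow> seq set" where
  "supp_upto N = {u. \<forall>n. n = 0 \<or> N < n \<longrightarrow> u n = 0}"

definition unit_seq :: "nat \<Rightarrow> seq" where
  "unit_seq j = (\<lambda>n. if n = j then 1 else 0)"

definition mat_op :: "(nat \<Rightarrow> nat \<Rightarrow> real) \<Rightarrow> seq \<Rightarrow> seq" where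
  "mat_op M f = (\<lambda>n. if n = 0 then 0 else (\<Sum>j. M n (Suc j) * f (Suc j)))"

lemma supp_uptoD: "u \<in> supp_upto N \<Longrightarrow> n = 0 \<or> N < n \<Longrightarrow> u n = 0"
  by (auto simp: supp_upto_def)

lemma supp_upto_mono: "M \<le> N \<Longrightarrow> u \<in> supp_upto M \<Longrightarrow> u \<in> supp_upto N"
  by (auto simp: supp_upto_def)

lemma supp_upto_lincomb:
  "u \<in> supp_upto N \<Longrightarrow> v \<in> supp_upto N \<Longrightarrow> (\<lambda>n. c * u n + d * v n) \<in> supp_upto N"
  by (auto simp: supp_upto_def)

lemma supp_upto_diff:
  "u \<in> supp_upto N \<Longrightarrow> v \<in> supp_upto N \<Longrightarrow> (\<lambda>n. u n - v n) \<in> supp_upto N"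
  by (auto simp: supp_upto_def)

lemma trunc_supp: "f 0 = 0 \<Longrightarrow> trunc N f \<in> supp_upto N"
  by (auto simp: supp_upto_def trunc_def)

lemma ell1_zero: "f \<in> ell1 w \<Longrightarrow> f 0 = 0"
  by (simp add: ell1_def)

lemma sums_supp:
  assumes "u \<in> supp_upto N"
  shows "(\<lambda>j. M (Suc j) * u (Suc j)) sums (\<Sum>j=1..N. M j * u j)"
proof -
  have "(\<lambda>j. M (Suc j) * u (Suc j)) sums (\<Sum>j<N. M (Suc j) * u (Suc j))"
    by (rule sums_finite) (use assms in \<open>auto simp: supp_upto_def\<close>)
  then show ?thesis using sum_Suc_conv[of "\<lambda>j. M j * u j" N] by simp
qed

lemma mat_op_supp:
  "u \<in> supp_upto N \<Longrightarrow> n \<ge> 1 \<Longrightarrow> mat_op M u n = (\<Sum>j=1..N. M n j * u j)"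
  using sums_unique[OF sums_supp[of u N "M n"]] by (simp add: mat_op_def)

section \<open>The norm of \<open>ell1 w\<close>\<close>

locale weighted =
  fixes w :: seq
  assumes weight: "weight w"
begin

lemma w_pos: "n \<ge> 1 \<Longrightarrow> 0 < w n"
  using weight by (simp add: weight_def)

lemma w_nonneg: "n \<ge> 1 \<Longrightarrow> 0 \<le> w n"
  using w_pos[of n] by simp

lemma w_Suc_nonneg: "0 \<le> w (Suc n)"
  using w_nonneg[of "Suc n"] by simp

text \<open>All terms are nonnegative, so bounded partial sums give both summability and the norm
  bound. Later norm estimates thereby reduce to finite sums.\<close>

lemma ell1_bounded:
  assumes "f 0 = 0" "\<And>N. (\<Sum>n=1..N. w n * \<bar>f n\<bar>) \<le> C"
  shows "f \<in> ell1 w" "wnorm w f \<le> C"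
proof -
  have b: "(\<Sum>n<N. w (Suc n) * \<bar>f (Suc n)\<bar>) \<le> C" for N
    using assms(2)[of N] sum_Suc_conv[of "\<lambda>n. w n * \<bar>f n\<bar>" N] by simp
  have s: "summable (\<lambda>n. w (Suc n) * \<bar>f (Suc n)\<bar>)"
    by (rule summableI_nonneg_bounded[OF _ b]) (use w_Suc_nonneg in auto)
  then show "f \<in> ell1 w" using assms(1) by (simp add: ell1_def)
  show "wnorm w f \<le> C" unfolding wnorm_def by (rule suminf_le_const[OF s b])
qed

lemma wnorm_nonneg: "f \<in> ell1 w \<Longrightarrow> 0 \<le> wnorm w f"
  unfolding wnorm_def ell1_def by (auto intro!: suminf_nonneg mult_nonneg_nonneg w_Suc_nonneg)

lemma wnorm_partial: "f \<in> ell1 w \<Longrightarrow> (\<Sum>n=1..N. w n * \<bar>f n\<bar>) \<le> wnorm w f"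
  unfolding wnorm_def ell1_def sum_Suc_conv[of "\<lambda>n. w n * \<bar>f n\<bar>" N, symmetric]
  by (auto intro!: sum_le_suminf mult_nonneg_nonneg w_Suc_nonneg)

lemma ell1_add:
  assumes "f \<in> ell1 w" "g \<in> ell1 w"
  shows "(\<lambda>n. f n + g n) \<in> ell1 w" "wnorm w (\<lambda>n. f n + g n) \<le> wnorm w f + wnorm w g"
proof -
  have "(\<Sum>n=1..N. w n * \<bar>f n + g n\<bar>) \<le> wnorm w f + wnorm w g" for N
  proof -
    have "(\<Sum>n=1..N. w n * \<bar>f n + g n\<bar>) \<le> (\<Sum>n=1..N. w n * \<bar>f n\<bar> + w n * \<bar>g n\<bar>)"
      unfolding distrib_left[symmetric]
      by (intro sum_mono mult_left_mono abs_triangle_ineq) (use w_pos in force)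
    also have "\<dots> \<le> wnorm w f + wnorm w g"
      unfolding sum.distrib by (intro add_mono wnorm_partial assms)
    finally show ?thesis .
  qed
  note b = this
  have z: "f 0 + g 0 = 0" using assms by (simp add: ell1_def)
  show "(\<lambda>n. f n + g n) \<in> ell1 w" "wnorm w (\<lambda>n. f n + g n) \<le> wnorm w f + wnorm w g"
    using ell1_bounded[of "\<lambda>n. f n + g n", OF z b] by auto
qed

lemma ell1_scale:
  assumes "f \<in> ell1 w"
  shows "(\<lambda>n. c * f n) \<in> ell1 w" "wnorm w (\<lambda>n. c * f n) = \<bar>c\<bar> * wnorm w f"
proof -
  have s: "summable (\<lambda>n. w (Suc n) * \<bar>f (Suc n)\<bar>)" using assms by (simp add: ell1_def)
  have eq: "(\<lambda>n. w (Suc n) * \<bar>c * f (Suc n)\<bar>) = (\<lambda>n. \<bar>c\<bar> * (w (Suc n) * \<bar>f (Suc n)\<bar>))"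
    by (simp add: abs_mult mult_ac)
  show "(\<lambda>n. c * f n) \<in> ell1 w"
    using assms by (simp add: ell1_def eq summable_mult)
  show "wnorm w (\<lambda>n. c * f n) = \<bar>c\<bar> * wnorm w f"
    unfolding wnorm_def eq by (rule suminf_mult[OF s])
qed

lemma ell1_diff:
  assumes "f \<in> ell1 w" "g \<in> ell1 w"
  shows "(\<lambda>n. f n - g n) \<in> ell1 w" "wnorm w (\<lambda>n. f n - g n) \<le> wnorm w f + wnorm w g"
  using ell1_add[OF assms(1) ell1_scale(1)[OF assms(2), of "-1"]]
    ell1_scale(2)[OF assms(2), of "-1"] by simp_all

lemma wnorm_commute: "wnorm w (\<lambda>n. f n - g n) = wnorm w (\<lambda>n. g n - f n)"
  by (simp add: wnorm_def abs_minus_commute)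

lemma wnorm_triangle:
  assumes "f \<in> ell1 w" "g \<in> ell1 w" "h \<in> ell1 w"
  shows "wnorm w (\<lambda>n. f n - h n) \<le> wnorm w (\<lambda>n. f n - g n) + wnorm w (\<lambda>n. g n - h n)"
  using ell1_add(2)[OF ell1_diff(1)[OF assms(1,2)] ell1_diff(1)[OF assms(2,3)]] by simp

lemma wnorm_diff_abs:
  assumes "f \<in> ell1 w" "g \<in> ell1 w"
  shows "\<bar>wnorm w f - wnorm w g\<bar> \<le> wnorm w (\<lambda>n. f n - g n)"
  using ell1_add(2)[OF ell1_diff(1)[OF assms] assms(2)]
    ell1_add(2)[OF ell1_diff(1)[OF assms(2,1)] assms(1)] wnorm_commute[of f g] by simp

lemma wnorm_eq_0:
  assumes "f \<in> ell1 w" "wnorm w f \<le> 0"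
  shows "f = (\<lambda>n. 0)"
proof
  fix n
  show "f n = 0"
  proof (cases n)
    case 0 then show ?thesis using assms by (simp add: ell1_def)
  next
    case (Suc m)
    have "w n * \<bar>f n\<bar> \<le> (\<Sum>k=1..n. w k * \<bar>f k\<bar>)"
      by (rule member_le_sum) (use Suc w_nonneg in \<open>auto intro!: mult_nonneg_nonneg\<close>)
    also have "\<dots> \<le> 0" using wnorm_partial[OF assms(1), of n] assms(2) by simp
    finally show ?thesis using w_pos[of n] Suc by (simp add: mult_le_0_iff)
  qed
qed

lemma supp_ell1:
  assumes "u \<in> supp_upto N"
  shows "u \<in> ell1 w" "wnorm w u = (\<Sum>n=1..N. w n * \<bar>u n\<bar>)"
proof -
  have "(\<lambda>n. \<bar>u n\<bar>) \<in> supp_upto N" using assms by (simp add: supp_upto_def)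
  note s = sums_supp[OF this, of w]
  show "u \<in> ell1 w" using assms sums_summable[OF s] by (auto simp: ell1_def supp_upto_def)
  show "wnorm w u = (\<Sum>n=1..N. w n * \<bar>u n\<bar>)" using sums_unique[OF s] by (simp add: wnorm_def)
qed

lemma trunc_tendsto:
  assumes "f \<in> ell1 w"
  shows "(\<lambda>N. wnorm w (\<lambda>n. trunc N f n - f n)) \<longlonglongrightarrow> 0"
proof -
  have s: "summable (\<lambda>n. w (Suc n) * \<bar>f (Suc n)\<bar>)" using assms by (simp add: ell1_def)
  have z: "f 0 = 0" by (rule ell1_zero[OF assms])
  \<comment> \<open>Truncation keeps the first \<open>N\<close> terms and deletes the rest, so the
    error is exactly the tail of the series for \<open>wnorm w f\<close>.\<close>
  have "wnorm w (\<lambda>n. trunc N f n - f n) = wnorm w f - (\<Sum>n<N. w (Suc n) * \<bar>f (Suc n)\<bar>)" for N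
  proof -
    note t = supp_ell1[OF trunc_supp[of f N, OF z]]
    have "(\<Sum>n=1..N. w n * \<bar>trunc N f n\<bar>) = (\<Sum>n=1..N. w n * \<bar>f n\<bar>)"
      by (rule sum.cong) (auto simp: trunc_def)
    then have tn: "wnorm w (trunc N f) = (\<Sum>n<N. w (Suc n) * \<bar>f (Suc n)\<bar>)"
      using t(2) sum_Suc_conv[of "\<lambda>n. w n * \<bar>f n\<bar>" N] by simp
    have "wnorm w f - wnorm w (trunc N f) =
      (\<Sum>n. w (Suc n) * \<bar>f (Suc n)\<bar> - w (Suc n) * \<bar>trunc N f (Suc n)\<bar>)"
      unfolding wnorm_def
      by (rule suminf_diff[OF s]) (use t(1) in \<open>simp add: ell1_def\<close>)
    also have "\<dots> = wnorm w (\<lambda>n. trunc N f n - f n)"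
      unfolding wnorm_def by (rule suminf_cong) (simp add: trunc_def)
    finally show ?thesis using tn by simp
  qed
  moreover have "(\<lambda>N. wnorm w f - (\<Sum>n<N. w (Suc n) * \<bar>f (Suc n)\<bar>)) \<longlonglongrightarrow> wnorm w f - wnorm w f"
    unfolding wnorm_def by (intro tendsto_intros summable_LIMSEQ s)
  ultimately show ?thesis by simp
qed

lemma trunc_approx:
  assumes "f \<in> ell1 w" "0 < e"
  obtains N where "trunc N f \<in> supp_upto N" "trunc N f \<in> ell1 w"
    "wnorm w (\<lambda>n. trunc N f n - f n) < e"
proof -
  have "eventually (\<lambda>N. wnorm w (\<lambda>n. trunc N f n - f n) < e) sequentially"
    using order_tendstoD(2)[OF trunc_tendsto[OF assms(1)] assms(2)] .
  then obtain N where "wnorm w (\<lambda>n. trunc N f n - f n) < e"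
    by (auto simp: eventually_sequentially)
  with that trunc_supp[of f, OF ell1_zero[OF assms(1)]] supp_ell1(1) show ?thesis by blast
qed

section \<open>Matrices acting as contractions\<close>

text \<open>A column-sum test: interchanging the two summations turns the bound on each column into
  a bound for the operator norm. The same bound gives
  \<open>\<bar>M n j\<bar> \<le> w j / w n\<close>, which makes every row series absolutely
  convergent on \<open>ell1 w\<close>.\<close>

lemma mat_op_bound:
  assumes M: "\<And>N j. j \<ge> 1 \<Longrightarrow> (\<Sum>n=1..N. w n * \<bar>M n j\<bar>) \<le> w j"
    and f: "f \<in> ell1 w"
  shows "n \<ge> 1 \<Longrightarrow> summable (\<lambda>j. M n (Suc j) * f (Suc j))" (is "_ \<Longrightarrow> ?sm")
    and "mat_op M f \<in> ell1 w" and "wnorm w (mat_op M f) \<le> wnorm w f"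
proof -
  have sf: "summable (\<lambda>n. w (Suc n) * \<bar>f (Suc n)\<bar>)" using f by (simp add: ell1_def)
  have sa: "summable (\<lambda>j. \<bar>M n (Suc j) * f (Suc j)\<bar>)" if n: "n \<ge> 1" for n
  proof (rule summable_comparison_test')
    show "summable (\<lambda>j. 1 / w n * (w (Suc j) * \<bar>f (Suc j)\<bar>))" by (intro summable_mult sf)
    fix j
    have "w n * \<bar>M n (Suc j)\<bar> \<le> (\<Sum>k=1..n. w k * \<bar>M k (Suc j)\<bar>)"
      by (rule member_le_sum) (use n w_nonneg in \<open>auto intro!: mult_nonneg_nonneg\<close>)
    also have "\<dots> \<le> w (Suc j)" by (rule M) simp
    finally have "\<bar>M n (Suc j)\<bar> \<le> 1 / w n * w (Suc j)"
      using w_pos[OF n] by (simp add: field_simps)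
    from mult_right_mono[OF this, of "\<bar>f (Suc j)\<bar>"]
    show "norm \<bar>M n (Suc j) * f (Suc j)\<bar> \<le> 1 / w n * (w (Suc j) * \<bar>f (Suc j)\<bar>)"
      by (simp add: abs_mult)
  qed
  show "n \<ge> 1 \<Longrightarrow> ?sm" using summable_rabs_cancel[OF sa] .
  have "(\<Sum>n=1..N. w n * \<bar>mat_op M f n\<bar>) \<le> wnorm w f" for N
  proof -
    have "(\<Sum>n=1..N. w n * \<bar>mat_op M f n\<bar>) \<le>
      (\<Sum>n=1..N. (\<Sum>j. w n * \<bar>M n (Suc j) * f (Suc j)\<bar>))"
    proof (rule sum_mono)
      fix n assume n: "n \<in> {1..N}"
      then have "\<bar>mat_op M f n\<bar> \<le> (\<Sum>j. \<bar>M n (Suc j) * f (Suc j)\<bar>)"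
        using summable_rabs[OF sa[of n]] by (auto simp: mat_op_def)
      then show "w n * \<bar>mat_op M f n\<bar> \<le> (\<Sum>j. w n * \<bar>M n (Suc j) * f (Suc j)\<bar>)"
        using n w_pos[of n] suminf_mult[OF sa[of n], of "w n"] by simp
    qed
    also have "\<dots> = (\<Sum>j. \<Sum>n=1..N. w n * \<bar>M n (Suc j) * f (Suc j)\<bar>)"
      by (rule suminf_sum[symmetric]) (auto intro!: summable_mult sa)
    also have "\<dots> \<le> (\<Sum>j. w (Suc j) * \<bar>f (Suc j)\<bar>)"
    proof (rule suminf_le[OF _ _ sf])
      fix j
      have "(\<Sum>n=1..N. w n * \<bar>M n (Suc j) * f (Suc j)\<bar>) =
        (\<Sum>n=1..N. w n * \<bar>M n (Suc j)\<bar>) * \<bar>f (Suc j)\<bar>"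
        by (simp add: sum_distrib_right abs_mult mult.assoc)
      also have "\<dots> \<le> w (Suc j) * \<bar>f (Suc j)\<bar>" by (intro mult_right_mono M) auto
      finally show "(\<Sum>n=1..N. w n * \<bar>M n (Suc j) * f (Suc j)\<bar>) \<le> w (Suc j) * \<bar>f (Suc j)\<bar>" .
    qed (auto intro!: summable_sum summable_mult sa)
    finally show ?thesis by (simp add: wnorm_def)
  qed
  note b = this
  show "mat_op M f \<in> ell1 w" "wnorm w (mat_op M f) \<le> wnorm w f"
    using ell1_bounded[OF _ b] by (auto simp: mat_op_def)
qed

lemma mat_op_linear:
  assumes M: "\<And>N j. j \<ge> 1 \<Longrightarrow> (\<Sum>n=1..N. w n * \<bar>M n j\<bar>) \<le> w j"
    and f: "f \<in> ell1 w" and g: "g \<in> ell1 w"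
  shows "mat_op M (\<lambda>n. f n + g n) = (\<lambda>n. mat_op M f n + mat_op M g n)"
    and "mat_op M (\<lambda>n. c * f n) = (\<lambda>n. c * mat_op M f n)"
    and "mat_op M (\<lambda>n. f n - g n) = (\<lambda>n. mat_op M f n - mat_op M g n)"
proof -
  have s: "summable (\<lambda>j. M n (Suc j) * f (Suc j))" "summable (\<lambda>j. M n (Suc j) * g (Suc j))"
    if "n \<ge> 1" for n
    using mat_op_bound(1)[OF M] f g that by auto
  show "mat_op M (\<lambda>n. f n + g n) = (\<lambda>n. mat_op M f n + mat_op M g n)"
    using suminf_add[OF s] by (auto simp: mat_op_def fun_eq_iff distrib_left)
  show "mat_op M (\<lambda>n. c * f n) = (\<lambda>n. c * mat_op M f n)"
    using suminf_mult[OF s(1), of _ c] by (auto simp: mat_op_def fun_eq_iff mult.left_commute)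
  show "mat_op M (\<lambda>n. f n - g n) = (\<lambda>n. mat_op M f n - mat_op M g n)"
    using suminf_diff[OF s] by (auto simp: mat_op_def fun_eq_iff right_diff_distrib)
qed

lemma mat_op_bounded_linear:
  assumes M: "\<And>N j. j \<ge> 1 \<Longrightarrow> (\<Sum>n=1..N. w n * \<bar>M n j\<bar>) \<le> w j"
  shows "bounded_linear_on_ell1 w (mat_op M)"
  unfolding bounded_linear_on_ell1_def
  using mat_op_bound(2,3)[OF M] mat_op_linear(1,2)[OF M]
  by (auto intro!: exI[of _ 1])

section \<open>Closures of graphs\<close>

text \<open>Replaces approximating sequences by one approximant for each error bound; conversely,
  the errors \<open>1 / Suc k\<close> yield a sequence.\<close>

lemma op_closure_iff:
  assumes "T \<subseteq> ell1 w \<times> ell1 w"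
  shows "(f, g) \<in> op_closure w T \<longleftrightarrow> f \<in> ell1 w \<and> g \<in> ell1 w \<and>
    (\<forall>e>0. \<exists>(u, v)\<in>T. wnorm w (\<lambda>n. u n - f n) < e \<and> wnorm w (\<lambda>n. v n - g n) < e)"
    (is "?l \<longleftrightarrow> ?r")
proof
  assume ?l
  then obtain u v where uv: "f \<in> ell1 w" "g \<in> ell1 w" "\<And>k::nat. (u k, v k) \<in> T"
    "(\<lambda>k. wnorm w (\<lambda>n. u k n - f n)) \<longlonglongrightarrow> 0" "(\<lambda>k. wnorm w (\<lambda>n. v k n - g n)) \<longlonglongrightarrow> 0"
    by (auto simp: op_closure_def)
  have "\<exists>(u, v)\<in>T. wnorm w (\<lambda>n. u n - f n) < e \<and> wnorm w (\<lambda>n. v n - g n) < e" if "e > 0" for e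
  proof -
    have "eventually (\<lambda>k. wnorm w (\<lambda>n. u k n - f n) < e \<and> wnorm w (\<lambda>n. v k n - g n) < e) sequentially"
      by (intro eventually_conj order_tendstoD(2)[OF uv(4) that] order_tendstoD(2)[OF uv(5) that])
    then obtain k where "wnorm w (\<lambda>n. u k n - f n) < e \<and> wnorm w (\<lambda>n. v k n - g n) < e"
      by (auto simp: eventually_sequentially)
    then show ?thesis using uv(3)[of k] by auto
  qed
  then show ?r using uv by blast
next
  assume r: ?r
  have "\<exists>u v. (u, v) \<in> T \<and> wnorm w (\<lambda>n. u n - f n) < 1 / Suc k \<and>
    wnorm w (\<lambda>n. v n - g n) < 1 / Suc k" for k :: nat
    using r[THEN conjunct2, THEN conjunct2, rule_format, of "1 / Suc k"] by auto
  then obtain u v where uv: "\<And>k::nat. (u k, v k) \<in> T"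
    "\<And>k. wnorm w (\<lambda>n. u k n - f n) < 1 / Suc k" "\<And>k. wnorm w (\<lambda>n. v k n - g n) < 1 / Suc k"
    by metis
  have ell: "u k \<in> ell1 w" "v k \<in> ell1 w" for k using uv(1)[of k] assms by auto
  have lim: "(\<lambda>k. 1 / real (Suc k)) \<longlonglongrightarrow> 0" by (rule LIMSEQ_Suc[OF lim_1_over_n])
  have z: "(\<lambda>k. wnorm w (\<lambda>n. x k n - h n)) \<longlonglongrightarrow> 0"
    if "\<And>k. x k \<in> ell1 w" "h \<in> ell1 w" "\<And>k. wnorm w (\<lambda>n. x k n - h n) < 1 / Suc k" for x h
  proof (rule tendsto_sandwich[OF _ _ tendsto_const lim])
    show "eventually (\<lambda>k. 0 \<le> wnorm w (\<lambda>n. x k n - h n)) sequentially"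
      by (intro always_eventually allI wnorm_nonneg ell1_diff that)
    show "eventually (\<lambda>k. wnorm w (\<lambda>n. x k n - h n) \<le> 1 / real (Suc k)) sequentially"
      by (intro always_eventually allI less_imp_le that)
  qed
  have "(\<lambda>k. wnorm w (\<lambda>n. u k n - f n)) \<longlonglongrightarrow> 0" "(\<lambda>k. wnorm w (\<lambda>n. v k n - g n)) \<longlonglongrightarrow> 0"
    using r by (intro z ell uv(2,3); simp)+
  then show ?l using uv(1) r by (auto simp: op_closure_def)
qed

text \<open>Closing twice adds nothing: an approximant in \<open>T\<close> within
  \<open>e / 2\<close> is itself approximated within \<open>e / 2\<close> by a member of
  \<open>U\<close>.\<close>

lemma op_closure_sub:
  assumes T: "T \<subseteq> op_closure w U" and U: "U \<subseteq> ell1 w \<times> ell1 w"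
  shows "op_closure w T \<subseteq> op_closure w U"
proof clarify
  fix f g assume fg: "(f, g) \<in> op_closure w T"
  have Te: "T \<subseteq> ell1 w \<times> ell1 w" using T by (auto simp: op_closure_def)
  have fge: "f \<in> ell1 w" "g \<in> ell1 w" using fg by (auto simp: op_closure_def)
  show "(f, g) \<in> op_closure w U"
    unfolding op_closure_iff[OF U]
  proof (intro conjI allI impI fge)
    fix e :: real assume "e > 0"
    then have e: "e / 2 > 0" by simp
    from fg e obtain u v where uv: "(u, v) \<in> T" "wnorm w (\<lambda>n. u n - f n) < e / 2"
      "wnorm w (\<lambda>n. v n - g n) < e / 2"
      unfolding op_closure_iff[OF Te] by blast
    then have "(u, v) \<in> op_closure w U" using T by auto
    with e obtain x y where xy: "(x, y) \<in> U" "wnorm w (\<lambda>n. x n - u n) < e / 2"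
      "wnorm w (\<lambda>n. y n - v n) < e / 2"
      unfolding op_closure_iff[OF U] by blast
    have "wnorm w (\<lambda>n. x n - f n) < e"
      using wnorm_triangle[of x u f] uv xy Te U fge by fastforce
    moreover have "wnorm w (\<lambda>n. y n - g n) < e"
      using wnorm_triangle[of y v g] uv xy Te U fge by fastforce
    ultimately show "\<exists>(u, v)\<in>U. wnorm w (\<lambda>n. u n - f n) < e \<and> wnorm w (\<lambda>n. v n - g n) < e"
      using xy by auto
  qed
qed

end

section \<open>The triangular flow\<close>

text \<open>\<open>B_map\<close> starts its series at column \<open>n + 1\<close>, whereas
  \<open>mat_op\<close> runs over all columns from 1. The first \<open>n\<close> terms vanish by
  triangularity, so \<open>B\<close> is the matrix \<open>b\<close> after multiplication by
  \<open>a\<close>, and matrix bounds become available.\<close>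

lemma B_map_shift:
  assumes z: "\<And>j. 1 \<le> j \<Longrightarrow> j \<le> n \<Longrightarrow> b n j = 0" and n: "n \<ge> 1"
    and s: "summable (\<lambda>j. b n (Suc j) * (a (Suc j) * f (Suc j)))"
  shows "summable (\<lambda>k. a (n + 1 + k) * b n (n + 1 + k) * f (n + 1 + k))"
    and "B_map a b f n = mat_op b (\<lambda>n. a n * f n) n"
proof -
  define h where "h j = b n (Suc j) * (a (Suc j) * f (Suc j))" for j
  have h: "a (n + 1 + k) * b n (n + 1 + k) * f (n + 1 + k) = h (k + n)" for k
    by (simp add: h_def mult_ac add.commute)
  have sh: "summable h" using s unfolding h_def .
  have sn: "summable (\<lambda>k. h (k + n))" using sh by (rule summable_ignore_initial_segment)
  then show "summable (\<lambda>k. a (n + 1 + k) * b n (n + 1 + k) * f (n + 1 + k))"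
    by (simp only: h)
  have "(\<Sum>j<n. h j) = 0" by (rule sum.neutral) (use z in \<open>auto simp: h_def\<close>)
  then have "suminf h = (\<Sum>k. h (k + n))"
    using suminf_split_initial_segment[OF sh, of n] by simp
  moreover have "mat_op b (\<lambda>n. a n * f n) n = suminf h"
    using n by (simp add: mat_op_def h_def[abs_def])
  moreover have "B_map a b f n = (\<Sum>k. h (k + n))"
    using n by (simp only: B_map_def h) simp
  ultimately show "B_map a b f n = mat_op b (\<lambda>n. a n * f n) n" by simp
qed

definition AB_map :: "seq \<Rightarrow> (nat \<Rightarrow> nat \<Rightarrow> real) \<Rightarrow> seq \<Rightarrow> seq" where
  "AB_map a b u = (\<lambda>n. - a n * u n + B_map a b u n)"

text \<open>Entry \<open>(n, j)\<close> of the exponential series of \<open>t L\<close>. It is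
  written as a power series in \<open>t\<close> with explicit coefficients, so that termwise
  differentiation applies.\<close>

definition flow_col :: "seq \<Rightarrow> (nat \<Rightarrow> nat \<Rightarrow> real) \<Rightarrow> real \<Rightarrow> nat \<Rightarrow> nat \<Rightarrow> real" where
  "flow_col a b t n j = (\<Sum>k. ((AB_map a b ^^ k) (unit_seq j) n / fact k) * t ^ k)"

definition flow :: "seq \<Rightarrow> (nat \<Rightarrow> nat \<Rightarrow> real) \<Rightarrow> real \<Rightarrow> seq \<Rightarrow> seq" where
  "flow a b t = mat_op (flow_col a b t)"

text \<open>The weight is kept out: the flow is determined by \<open>a\<close> and \<open>b\<close>,
  and the same flow is later studied in several weighted spaces.\<close>

locale fragmentation =
  fixes a :: seq and b :: "nat \<Rightarrow> nat \<Rightarrow> real"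
  assumes a_nonneg: "\<And>n. 1 \<le> n \<Longrightarrow> 0 \<le> a n"
    and b_nonneg: "\<And>n j. 1 \<le> n \<Longrightarrow> 1 \<le> j \<Longrightarrow> 0 \<le> b n j"
    and b_zero: "\<And>n j. 1 \<le> n \<Longrightarrow> 1 \<le> j \<Longrightarrow> j \<le> n \<Longrightarrow> b n j = 0"
begin

abbreviation L :: "seq \<Rightarrow> seq" where "L \<equiv> AB_map a b"
abbreviation p :: "real \<Rightarrow> nat \<Rightarrow> nat \<Rightarrow> real" where "p \<equiv> flow_col a b"
abbreviation S :: "real \<Rightarrow> seq \<Rightarrow> seq" where "S \<equiv> flow a b"

section \<open>\<open>L\<close> on finitely supported sequences\<close>

lemma L_0: "u 0 = 0 \<Longrightarrow> L u 0 = 0"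
  by (simp add: AB_map_def B_map_def)

lemma B_supp:
  assumes u: "u \<in> supp_upto N" and n: "n \<ge> 1"
  shows "summable (\<lambda>k. a (n + 1 + k) * b n (n + 1 + k) * u (n + 1 + k))"
    and "B_map a b u n = (\<Sum>j=1..N. b n j * (a j * u j))"
proof -
  have au: "(\<lambda>n. a n * u n) \<in> supp_upto N" using u by (simp add: supp_upto_def)
  note * = B_map_shift[of n b a u, OF b_zero[OF n] n sums_summable[OF sums_supp[OF au, of "b n"]]]
  show "summable (\<lambda>k. a (n + 1 + k) * b n (n + 1 + k) * u (n + 1 + k))" using * by blast
  show "B_map a b u n = (\<Sum>j=1..N. b n j * (a j * u j))" using * mat_op_supp[OF au n] by simp
qed

lemma L_supp:
  assumes "u \<in> supp_upto N" "n \<ge> 1"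
  shows "L u n = - a n * u n + (\<Sum>j=1..N. b n j * (a j * u j))"
  using B_supp(2)[OF assms] by (simp add: AB_map_def)

text \<open>Fragments are smaller than their parent: in rows \<open>n > N\<close> the matrix
  \<open>b\<close> vanishes at all columns \<open>j \<le> N\<close>.\<close>

lemma L_closed: "u \<in> supp_upto N \<Longrightarrow> L u \<in> supp_upto N"
proof -
  assume u: "u \<in> supp_upto N"
  have "L u n = 0" if "n = 0 \<or> N < n" for n
  proof (cases "n = 0")
    case True then show ?thesis using u L_0 by (auto simp: supp_upto_def)
  next
    case False
    then have "(\<Sum>j=1..N. b n j * (a j * u j)) = 0"
      using that by (intro sum.neutral) (auto simp: b_zero)
    then show ?thesis using False that L_supp[OF u, of n] u by (auto simp: supp_upto_def)
  qed
  then show ?thesis by (auto simp: supp_upto_def)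
qed

lemma L_pow_closed: "u \<in> supp_upto N \<Longrightarrow> (L ^^ k) u \<in> supp_upto N"
  by (induction k) (auto intro: L_closed)

lemma L_sum:
  assumes u: "\<And>i. i \<in> I \<Longrightarrow> u i \<in> supp_upto N"
  shows "L (\<lambda>n. \<Sum>i\<in>I. c i * u i n) = (\<lambda>n. \<Sum>i\<in>I. c i * L (u i) n)"
proof
  fix n
  have s: "(\<lambda>n. \<Sum>i\<in>I. c i * u i n) \<in> supp_upto N"
    using u by (auto simp: supp_upto_def intro!: sum.neutral)
  show "L (\<lambda>n. \<Sum>i\<in>I. c i * u i n) n = (\<Sum>i\<in>I. c i * L (u i) n)"
  proof (cases "n = 0")
    case True
    have "(\<Sum>i\<in>I. c i * L (u i) 0) = 0"
      using u L_0 by (intro sum.neutral) (auto simp: supp_upto_def)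
    then show ?thesis using True L_0[of "\<lambda>n. \<Sum>i\<in>I. c i * u i n"] s by (auto simp: supp_upto_def)
  next
    case False
    then have n: "n \<ge> 1" by simp
    have "L (\<lambda>n. \<Sum>i\<in>I. c i * u i n) n =
      - a n * (\<Sum>i\<in>I. c i * u i n) + (\<Sum>j=1..N. \<Sum>i\<in>I. c i * (b n j * (a j * u i j)))"
      unfolding L_supp[OF s n] by (simp add: sum_distrib_left mult_ac)
    also have "(\<Sum>j=1..N. \<Sum>i\<in>I. c i * (b n j * (a j * u i j))) =
      (\<Sum>i\<in>I. \<Sum>j=1..N. c i * (b n j * (a j * u i j)))"
      by (rule sum.swap)
    also have "- a n * (\<Sum>i\<in>I. c i * u i n) + \<dots> =
      (\<Sum>i\<in>I. c i * (- a n * u i n)) + (\<Sum>i\<in>I. c i * (\<Sum>j=1..N. b n j * (a j * u i j)))"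
      by (simp add: sum_distrib_left mult_ac)
    also have "\<dots> = (\<Sum>i\<in>I. c i * L (u i) n)"
      unfolding sum.distrib[symmetric] distrib_left[symmetric]
      by (rule sum.cong) (use L_supp[OF u n] in auto)
    finally show ?thesis .
  qed
qed

lemma L_lincomb:
  assumes "u \<in> supp_upto N" "v \<in> supp_upto N"
  shows "L (\<lambda>n. c * u n + d * v n) = (\<lambda>n. c * L u n + d * L v n)"
proof -
  \<comment> \<open>The two-term combination is a finite sum indexed by truth values.\<close>
  have "L (\<lambda>n. \<Sum>i\<in>{True, False}. (if i then c else d) * (if i then u else v) n) =
    (\<lambda>n. \<Sum>i\<in>{True, False}. (if i then c else d) * L (if i then u else v) n)"
    by (rule L_sum) (use assms in auto)
  then show ?thesis by simp
qed

section \<open>The finite linear systems \<open>u' = L u\<close>\<close>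

text \<open>The equation is imposed at all real times, so that time shifts of solutions are
  solutions and the derivative at 0 is two-sided.\<close>

definition sol :: "nat \<Rightarrow> (real \<Rightarrow> seq) \<Rightarrow> bool" where
  "sol N u \<longleftrightarrow> (\<forall>t. u t \<in> supp_upto N) \<and>
    (\<forall>t n. ((\<lambda>t. u t n) has_real_derivative L (u t) n) (at t))"

lemma solD:
  assumes "sol N u"
  shows "u t \<in> supp_upto N" "((\<lambda>t. u t n) has_real_derivative L (u t) n) (at t)"
  using assms by (auto simp: sol_def)

lemma sol_lincomb:
  assumes "sol N u" "sol N v"
  shows "sol N (\<lambda>t n. c * u t n + d * v t n)"
  unfolding sol_def
proof (intro conjI allI)
  fix t n
  show "(\<lambda>n. c * u t n + d * v t n) \<in> supp_upto N"
    by (intro supp_upto_lincomb solD(1)[OF assms(1)] solD(1)[OF assms(2)])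
  show "((\<lambda>t. c * u t n + d * v t n) has_real_derivative L (\<lambda>n. c * u t n + d * v t n) n) (at t)"
    unfolding L_lincomb[OF solD(1)[OF assms(1)] solD(1)[OF assms(2)]]
    by (intro DERIV_add DERIV_cmult solD(2)[OF assms(1)] solD(2)[OF assms(2)])
qed

lemma sol_sum:
  assumes u: "\<And>i. i \<in> I \<Longrightarrow> sol N (u i)"
  shows "sol N (\<lambda>t n. \<Sum>i\<in>I. c i * u i t n)"
  unfolding sol_def
proof (intro conjI allI)
  fix t n
  have s: "u i t \<in> supp_upto N" if "i \<in> I" for i using solD(1)[OF u[OF that]] .
  then show "(\<lambda>n. \<Sum>i\<in>I. c i * u i t n) \<in> supp_upto N"
    by (auto simp: supp_upto_def intro!: sum.neutral)
  have "((\<lambda>t. \<Sum>i\<in>I. c i * u i t n) has_real_derivative (\<Sum>i\<in>I. c i * L (u i t) n)) (at t)"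
    by (rule DERIV_sum, rule DERIV_cmult, rule solD(2), rule u)
  then show "((\<lambda>t. \<Sum>i\<in>I. c i * u i t n) has_real_derivative L (\<lambda>n. \<Sum>i\<in>I. c i * u i t n) n) (at t)"
    by (simp only: L_sum[of I "\<lambda>i. u i t" N c, OF s])
qed

lemma sol_shift:
  assumes "sol N u"
  shows "sol N (\<lambda>t. u (t + s))"
  unfolding sol_def
proof (intro conjI allI)
  fix t n
  show "u (t + s) \<in> supp_upto N" by (rule solD(1)[OF assms])
  show "((\<lambda>t. u (t + s) n) has_real_derivative L (u (t + s)) n) (at t)"
    using solD(2)[OF assms, of n "t + s"] by (rule DERIV_shift[THEN iffD1])
qed

text \<open>\<open>L\<close> has constant coefficients and finite rows on
  \<open>supp_upto N\<close>, so it commutes with the time derivative.\<close>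

lemma sol_L:
  assumes u: "sol N u"
  shows "sol N (\<lambda>t. L (u t))"
  unfolding sol_def
proof (intro conjI allI)
  fix t n
  show "L (u t) \<in> supp_upto N" by (intro L_closed solD(1)[OF u])
  show "((\<lambda>t. L (u t) n) has_real_derivative L (L (u t)) n) (at t)"
  proof (cases "n = 0")
    case True
    then have "L (u t) n = 0" "L (L (u t)) n = 0" for t
      using L_0[OF supp_uptoD[OF solD(1)[OF u]]] L_0 by auto
    then show ?thesis by simp
  next
    case False
    then have n: "n \<ge> 1" by simp
    have eq: "(\<lambda>t. L (u t) n) = (\<lambda>t. - a n * u t n + (\<Sum>j=1..N. b n j * (a j * u t j)))"
      by (rule ext) (rule L_supp[OF solD(1)[OF u] n])
    show ?thesis
      unfolding eq L_supp[OF L_closed[OF solD(1)[OF u]] n]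
      by (intro DERIV_add DERIV_cmult DERIV_sum solD(2)[OF u])
  qed
qed

text \<open>Integrating factors: \<open>exp (a n s) * u s n\<close> is nondecreasing once all components beyond
  \<open>n\<close> are known to be nonnegative.\<close>

lemma sol_nonneg:
  assumes u: "sol N u" and i: "\<And>n. 0 \<le> u 0 n" and t: "0 \<le> t"
  shows "0 \<le> u t n"
  using t
\<comment> \<open>The induction runs downwards from the largest component. The time stays arbitrary
  because the derivative of component \<open>n\<close> involves the higher components at all earlier
  times.\<close>
proof (induction "N - n" arbitrary: n t rule: less_induct)
  case less
  show ?case
  proof (cases "n = 0 \<or> N < n")
    case True then show ?thesis using supp_uptoD[OF solD(1)[OF u]] by simp
  next
    case False
    then have n: "n \<ge> 1" "n \<le> N" by auto
    define g where "g s = exp (a n * s) * u s n" for s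
    have "g 0 \<le> g t"
    proof (rule DERIV_nonneg_imp_nondecreasing[OF less.prems])
      fix s assume s: "0 \<le> s" "s \<le> t"
      have "(g has_real_derivative exp (a n * s) * (\<Sum>j=1..N. b n j * (a j * u s j))) (at s)"
        unfolding g_def
        by (rule derivative_eq_intros solD(2)[OF u] refl)+
          (simp add: L_supp[OF solD(1)[OF u] n(1)] algebra_simps)
      moreover have "0 \<le> b n j * (a j * u s j)" if j: "j \<in> {1..N}" for j
      proof (cases "j \<le> n")
        case True then show ?thesis using n j b_zero[of n j] by simp
      next
        case False
        then have "N - j < N - n" using n j by auto
        from less.hyps[OF this s(1)] show ?thesis
          using n j a_nonneg[of j] b_nonneg[of n j] by simp
      qed
      then have "0 \<le> (\<Sum>j=1..N. b n j * (a j * u s j))" by (rule sum_nonneg)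
      ultimately show "\<exists>y. (g has_real_derivative y) (at s) \<and> 0 \<le> y"
        by (intro exI[of _ "exp (a n * s) * (\<Sum>j=1..N. b n j * (a j * u s j))"]) simp
    qed
    then have "0 \<le> exp (a n * t) * u t n" using i[of n] by (simp add: g_def)
    then show ?thesis by (simp add: zero_le_mult_iff)
  qed
qed

text \<open>Uniqueness follows from positivity: \<open>u - v\<close> and \<open>v - u\<close> both
  solve the system with initial value zero, hence both are nonnegative.\<close>

lemma sol_unique:
  assumes u: "sol N u" and v: "sol N v" and i: "u 0 = v 0" and t: "0 \<le> t"
  shows "u t = v t"
proof
  fix n
  have "0 \<le> 1 * u t n + (-1) * v t n"
    by (rule sol_nonneg[OF sol_lincomb[OF u v] _ t]) (simp add: i)
  moreover have "0 \<le> 1 * v t n + (-1) * u t n"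
    by (rule sol_nonneg[OF sol_lincomb[OF v u] _ t]) (simp add: i)
  ultimately show "u t n = v t n" by simp
qed

section \<open>The exponential series\<close>

lemma L_pow_bound:
  obtains K where "\<And>u k n. u \<in> supp_upto N \<Longrightarrow> \<bar>(L ^^ k) u n\<bar> \<le> K ^ k * (\<Sum>n=1..N. \<bar>u n\<bar>)"
proof -
  define q where "q u = (\<Sum>n=1..N. \<bar>u n\<bar>)" for u :: seq
  \<comment> \<open>\<open>R n\<close> is the absolute sum of row \<open>n\<close> of
    \<open>L\<close> on \<open>{1..N}\<close>, so \<open>K\<close> adds up the absolute values of
    all entries and bounds \<open>L\<close> in the unweighted norm \<open>q\<close>.\<close>
  define R where "R n = a n + (\<Sum>j=1..N. b n j * a j)" for n
  define K where "K = (\<Sum>n=1..N. R n)"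
  have q0: "0 \<le> q u" for u by (auto simp: q_def intro: sum_nonneg)
  have comp: "\<bar>u n\<bar> \<le> q u" if "u \<in> supp_upto N" for u n
  proof (cases "n \<in> {1..N}")
    case True then show ?thesis unfolding q_def by (intro member_le_sum) auto
  next
    case False
    then have "u n = 0" using supp_uptoD[OF that, of n] by auto
    then show ?thesis using q0 by simp
  qed
  have R0: "0 \<le> R n" if "n \<in> {1..N}" for n
    unfolding R_def using that
    by (intro add_nonneg_nonneg sum_nonneg mult_nonneg_nonneg a_nonneg b_nonneg) auto
  have K0: "0 \<le> K" unfolding K_def by (intro sum_nonneg R0)
  have step: "q (L u) \<le> K * q u" if u: "u \<in> supp_upto N" for u
  proof -
    have "\<bar>L u n\<bar> \<le> R n * q u" if n: "n \<in> {1..N}" for n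
    proof -
      have "L u n = - a n * u n + (\<Sum>j=1..N. b n j * (a j * u j))"
        using L_supp[OF u, of n] n by simp
      then have "\<bar>L u n\<bar> \<le> \<bar>a n * u n\<bar> + (\<Sum>j=1..N. \<bar>b n j * (a j * u j)\<bar>)"
        using abs_triangle_ineq[of "- (a n * u n)" "\<Sum>j=1..N. b n j * (a j * u j)"]
          sum_abs[of "\<lambda>j. b n j * (a j * u j)" "{1..N}"] by linarith
      also have "\<dots> \<le> a n * q u + (\<Sum>j=1..N. b n j * (a j * q u))"
        using n by (intro add_mono sum_mono)
          (auto simp: abs_mult a_nonneg b_nonneg intro!: mult_mono mult_left_mono comp u q0)
      also have "\<dots> = R n * q u" by (simp add: R_def algebra_simps sum_distrib_left)
      finally show ?thesis .
    qed
    then have "q (L u) \<le> (\<Sum>n=1..N. R n * q u)" unfolding q_def[of "L u"] by (rule sum_mono)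
    then show ?thesis by (simp add: K_def sum_distrib_right)
  qed
  have pow: "q ((L ^^ k) u) \<le> K ^ k * q u" if u: "u \<in> supp_upto N" for k u
  proof (induction k)
    case (Suc k)
    have "q ((L ^^ Suc k) u) \<le> K * q ((L ^^ k) u)" using step[OF L_pow_closed[OF u]] by simp
    also have "\<dots> \<le> K * (K ^ k * q u)" by (intro mult_left_mono Suc K0)
    finally show ?case by (simp add: mult.assoc)
  qed simp
  show ?thesis
    using that[of K] order_trans[OF comp[OF L_pow_closed] pow] by (auto simp: q_def)
qed

lemma unit_supp: "1 \<le> j \<Longrightarrow> j \<le> N \<Longrightarrow> unit_seq j \<in> supp_upto N"
  by (auto simp: unit_seq_def supp_upto_def)

lemma sol_col:
  assumes j: "1 \<le> j"
  shows "sol j (\<lambda>t n. p t n j)"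
proof -
  note e = unit_supp[OF j order_refl]
  define c where "c n k = (L ^^ k) (unit_seq j) n / fact k" for n k
  from L_pow_bound[of j] obtain K where K: "\<And>k n. \<bar>(L ^^ k) (unit_seq j) n\<bar> \<le>
      K ^ k * (\<Sum>n=1..j. \<bar>unit_seq j n\<bar>)"
    using e by metis
  define C where "C = (\<Sum>n=1..j. \<bar>unit_seq j n\<bar>)"
  \<comment> \<open>The powers of \<open>L\<close> grow at most geometrically, so the exponential
    series of \<open>K * \<bar>t\<bar>\<close> is a majorant up to the constant
    \<open>C\<close>.\<close>
  have sm: "summable (\<lambda>k. c n k * t ^ k)" for n t
  proof (rule summable_comparison_test')
    show "summable (\<lambda>k. C * (inverse (fact k) * (K * \<bar>t\<bar>) ^ k))"
      by (intro summable_mult summable_exp)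
    fix k
    have "\<bar>c n k * t ^ k\<bar> \<le> (K ^ k * C) / fact k * \<bar>t\<bar> ^ k"
      unfolding c_def abs_mult power_abs
      using K[of k n] by (intro mult_right_mono) (auto simp: C_def intro!: divide_right_mono)
    then show "norm (c n k * t ^ k) \<le> C * (inverse (fact k) * (K * \<bar>t\<bar>) ^ k)"
      by (simp add: field_simps power_mult_distrib)
  qed
  have pc: "p t n j = (\<Sum>k. c n k * t ^ k)" for t n by (simp add: flow_col_def c_def)
  have supp: "(\<lambda>n. p t n j) \<in> supp_upto j" for t
    using supp_uptoD[OF L_pow_closed[OF e]] by (auto simp: supp_upto_def pc c_def)
  \<comment> \<open>Differentiation shifts the coefficients by one, which amounts to one more
    application of \<open>L\<close>.\<close>
  have dc: "diffs (c n) k = L ((L ^^ k) (unit_seq j)) n / fact k" for n k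
    by (simp add: diffs_def c_def field_simps del: of_nat_Suc)
  have "((\<lambda>t. p t n j) has_real_derivative L (\<lambda>n. p t n j) n) (at t)" for t n
  proof -
    have "((\<lambda>t. p t n j) has_real_derivative (\<Sum>k. diffs (c n) k * t ^ k)) (at t)"
      unfolding pc by (rule termdiffs_strong_converges_everywhere[OF sm])
    also have "(\<Sum>k. diffs (c n) k * t ^ k) = L (\<lambda>n. p t n j) n"
    proof (cases "n = 0")
      case True
      have "L ((L ^^ k) (unit_seq j)) 0 = 0" for k
        using supp_uptoD[OF L_pow_closed[OF e, of "Suc k"], of 0] by simp
      then show ?thesis using True L_0 supp_uptoD[OF supp] by (simp add: dc)
    next
      case False
      then have n: "n \<ge> 1" by simp
      \<comment> \<open>On \<open>supp_upto j\<close> each component of \<open>L\<close> is a finite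
        sum, hence it can be exchanged with the series over \<open>k\<close>.\<close>
      have "(\<Sum>k. diffs (c n) k * t ^ k) =
        (\<Sum>k. - a n * (c n k * t ^ k) + (\<Sum>i=1..j. b n i * a i * (c i k * t ^ k)))"
        unfolding dc L_supp[OF L_pow_closed[OF e] n]
        by (rule suminf_cong)
          (simp add: c_def field_simps add_divide_distrib sum_divide_distrib sum_distrib_left)
      also have "\<dots> = (\<Sum>k. - a n * (c n k * t ^ k)) + (\<Sum>k. \<Sum>i=1..j. b n i * a i * (c i k * t ^ k))"
        by (intro suminf_add[symmetric] summable_mult summable_sum sm)
      also have "(\<Sum>k. \<Sum>i=1..j. b n i * a i * (c i k * t ^ k)) =
        (\<Sum>i=1..j. \<Sum>k. b n i * a i * (c i k * t ^ k))"
        by (intro suminf_sum summable_mult sm)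
      finally have "(\<Sum>k. diffs (c n) k * t ^ k) =
        - a n * (\<Sum>k. c n k * t ^ k) + (\<Sum>i=1..j. b n i * a i * (\<Sum>k. c i k * t ^ k))"
        by (simp only: suminf_mult[OF sm])
      moreover have "L (\<lambda>n. p t n j) n = - a n * p t n j + (\<Sum>i=1..j. b n i * (a i * p t i j))"
        by (rule L_supp[OF supp n])
      ultimately show ?thesis by (simp add: pc mult.assoc)
    qed
    finally show ?thesis .
  qed
  then show ?thesis using supp by (simp add: sol_def)
qed

lemma sol_mono: "sol M u \<Longrightarrow> M \<le> N \<Longrightarrow> sol N u"
  using supp_upto_mono by (auto simp: sol_def)

lemma col_0: "p 0 n j = unit_seq j n"
  unfolding flow_col_def powser_zero by simp

lemma col_nonneg: "1 \<le> j \<Longrightarrow> 0 \<le> t \<Longrightarrow> 0 \<le> p t n j"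
  using sol_nonneg[OF sol_col, of j t n] by (simp add: col_0 unit_seq_def)

section \<open>The flow on finitely supported sequences\<close>

text \<open>Superposition: for finite support the matrix product is a finite combination of columns,
  each of which is a solution.\<close>

lemma sol_S:
  assumes f: "f \<in> supp_upto N"
  shows "sol N (\<lambda>t. S t f)"
proof -
  have c: "sol N (\<lambda>t n. p t n i)" if "i \<in> {1..N}" for i
    using sol_mono[OF sol_col] that by simp
  have "S t f n = (\<Sum>j=1..N. f j * p t n j)" for t n
  proof (cases "n = 0")
    case True
    then have "(\<Sum>j=1..N. f j * p t n j) = 0"
      using solD(1)[OF c] by (intro sum.neutral) (auto simp: supp_upto_def)
    then show ?thesis using True by (simp add: flow_def mat_op_def)
  next
    case False
    then show ?thesis using mat_op_supp[OF f, of n] by (simp add: flow_def mult.commute)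
  qed
  then have eq: "(\<lambda>t. S t f) = (\<lambda>t n. \<Sum>j=1..N. f j * p t n j)" by (intro ext)
  show ?thesis unfolding eq by (rule sol_sum[OF c])
qed

lemma S_0: "f 0 = 0 \<Longrightarrow> S 0 f = f"
proof
  fix n assume f: "f 0 = 0"
  show "S 0 f n = f n"
  proof (cases n)
    case 0 then show ?thesis using f by (simp add: flow_def mat_op_def)
  next
    case (Suc m)
    have "(\<lambda>j. p 0 n (Suc j) * f (Suc j)) = (\<lambda>j. if j = m then f n else 0)"
      by (auto simp: col_0 unit_seq_def Suc)
    then have "(\<lambda>j. p 0 n (Suc j) * f (Suc j)) sums f n"
      using sums_single[of m "\<lambda>_. f n"] by simp
    then show ?thesis using Suc by (simp add: flow_def mat_op_def sums_unique[symmetric])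
  qed
qed

text \<open>As functions of \<open>s\<close>, both sides solve the system with the same value at
  \<open>s = 0\<close>.\<close>

lemma S_supp_add:
  assumes f: "f \<in> supp_upto N" and "0 \<le> s" "0 \<le> t"
  shows "S (s + t) f = S s (S t f)"
  by (rule sol_unique[OF sol_shift[OF sol_S[OF f]] sol_S[OF solD(1)[OF sol_S[OF f]]] _ assms(2)])
    (use S_0 solD(1)[OF sol_S[OF f]] in \<open>simp add: supp_upto_def\<close>)

text \<open>As functions of \<open>t\<close>, both sides solve the system with initial value
  \<open>L f\<close>.\<close>

lemma S_L:
  assumes f: "f \<in> supp_upto N" and "0 \<le> t"
  shows "L (S t f) = S t (L f)"
  by (rule sol_unique[OF sol_L[OF sol_S[OF f]] sol_S[OF L_closed[OF f]] _ assms(2)])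
    (use S_0 f L_closed[OF f] in \<open>simp add: supp_upto_def\<close>)

text \<open>\<open>1 - L\<close> is upper triangular with diagonal \<open>1 + a n \<ge> 1\<close>, so it is inverted by back
  substitution.\<close>

lemma one_minus_L_surj:
  assumes "h \<in> supp_upto N"
  shows "\<exists>u\<in>supp_upto N. (\<lambda>n. u n - L u n) = h"
  using assms
proof (induction N arbitrary: h)
  case 0
  then have "h = (\<lambda>n. 0)" by (auto simp: supp_upto_def fun_eq_iff)
  moreover have "L (\<lambda>n. 0) = (\<lambda>n. 0)" using L_lincomb[of "\<lambda>n. 0" 0 "\<lambda>n. 0" 0 0] by (simp add: supp_upto_def)
  ultimately show ?case by (intro bexI[of _ "\<lambda>n. 0"]) (auto simp: supp_upto_def)
next
  case (Suc N)
  define e where "e = unit_seq (Suc N)"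
  define d where "d = 1 + a (Suc N)"
  \<comment> \<open>Subtracting \<open>c\<close> times \<open>e - L e\<close>, whose last component
    is the diagonal entry \<open>d\<close>, cancels the last component of \<open>h\<close>.\<close>
  define c where "c = h (Suc N) / d"
  have e: "e \<in> supp_upto (Suc N)" unfolding e_def by (rule unit_supp) auto
  have d: "d > 0" using a_nonneg[of "Suc N"] by (simp add: d_def)
  have Le: "e (Suc N) - L e (Suc N) = d"
  proof -
    have "(\<Sum>j=1..Suc N. b (Suc N) j * (a j * e j)) = 0"
      by (intro sum.neutral) (auto simp: b_zero)
    then show ?thesis using L_supp[OF e, of "Suc N"] by (simp add: d_def e_def unit_seq_def)
  qed
  define h' where "h' = (\<lambda>n. h n - c * (e n - L e n))"
  have "h' \<in> supp_upto (Suc N)" using Suc.prems e L_closed[OF e] by (simp add: supp_upto_def h'_def)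
  moreover have "h' (Suc N) = 0" using Le d by (simp add: h'_def c_def)
  ultimately have "h' \<in> supp_upto N" by (auto simp: supp_upto_def) (metis Suc_lessI)
  from Suc.IH[OF this] obtain u where u: "u \<in> supp_upto N" "(\<lambda>n. u n - L u n) = h'" by blast
  have u': "u \<in> supp_upto (Suc N)" using supp_upto_mono[OF _ u(1)] by simp
  show ?case
  proof (intro bexI)
    show "(\<lambda>n. 1 * u n + c * e n) \<in> supp_upto (Suc N)" by (rule supp_upto_lincomb[OF u' e])
    have "u n - L u n = h' n" for n using u(2) by (rule fun_cong)
    then show "(\<lambda>n. (1 * u n + c * e n) - L (\<lambda>n. 1 * u n + c * e n) n) = h"
      unfolding L_lincomb[OF u' e] by (simp add: h'_def fun_eq_iff algebra_simps)
  qed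
qed

end

section \<open>The semigroup and its generator\<close>

text \<open>The candidate core of the generator, kept as a graph so that \<open>op_closure\<close>
  applies; the same set serves every weight.\<close>

definition finite_core :: "seq \<Rightarrow> (nat \<Rightarrow> nat \<Rightarrow> real) \<Rightarrow> seq_op" where
  "finite_core a b = {(u, AB_map a b u) | u N. u \<in> supp_upto N}"

locale fragmentation_space = weighted w + fragmentation a b for w a b +
  assumes subinvariant: "\<And>j. 1 \<le> j \<Longrightarrow> (\<Sum>n=1..j-1. w n * b n j) \<le> w j"
begin

section \<open>The balance of weighted mass\<close>

lemma column_sum:
  assumes "j \<in> {1..N}"
  shows "(\<Sum>n=1..N. w n * b n j) = (\<Sum>n=1..j-1. w n * b n j)"
  by (rule sum.mono_neutral_right) (use assms in \<open>auto simp: b_zero\<close>)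

text \<open>Summing over fragments first, each parent \<open>j\<close> contributes its rate
  \<open>a j * u j\<close> times the defect of its column. Nonpositive defects give contractivity,
  and vanishing contributions give conservation.\<close>

lemma mass_L:
  assumes u: "u \<in> supp_upto N"
  shows "(\<Sum>n=1..N. w n * L u n) =
    (\<Sum>j=1..N. a j * u j * ((\<Sum>n=1..j-1. w n * b n j) - w j))"
proof -
  have "(\<Sum>n=1..N. w n * L u n) =
    (\<Sum>n=1..N. - (w n * (a n * u n)) + (\<Sum>j=1..N. w n * (b n j * (a j * u j))))"
    by (rule sum.cong) (simp_all add: L_supp[OF u] algebra_simps sum_distrib_left)
  also have "\<dots> = (\<Sum>j=1..N. - (w j * (a j * u j))) +
    (\<Sum>j=1..N. \<Sum>n=1..N. w n * (b n j * (a j * u j)))"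
    unfolding sum.distrib by (subst (2) sum.swap) (rule refl)
  also have "\<dots> = (\<Sum>j=1..N. a j * u j * ((\<Sum>n=1..N. w n * b n j) - w j))"
    unfolding sum.distrib[symmetric]
    by (rule sum.cong) (simp_all add: right_diff_distrib sum_distrib_left mult_ac)
  also have "\<dots> = (\<Sum>j=1..N. a j * u j * ((\<Sum>n=1..j-1. w n * b n j) - w j))"
    by (rule sum.cong) (simp_all only: column_sum)
  finally show ?thesis .
qed

lemma mass_deriv:
  assumes u: "sol N u"
  shows "((\<lambda>t. \<Sum>n=1..N. w n * u t n) has_real_derivative (\<Sum>n=1..N. w n * L (u t) n)) (at t)"
  by (intro DERIV_sum DERIV_cmult solD(2)[OF u])

lemma mass_le:
  assumes u: "sol N u" and i: "\<And>n. 0 \<le> u 0 n" and t: "0 \<le> t"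
  shows "(\<Sum>n=1..N. w n * u t n) \<le> (\<Sum>n=1..N. w n * u 0 n)"
proof (rule DERIV_nonpos_imp_nonincreasing[OF t])
  fix s assume "0 \<le> s" "s \<le> t"
  then have "a j * u s j * ((\<Sum>n=1..j-1. w n * b n j) - w j) \<le> 0" if "j \<in> {1..N}" for j
    using that subinvariant[of j] a_nonneg[of j] sol_nonneg[OF u i, of s j]
    by (intro mult_nonneg_nonpos) auto
  then have "(\<Sum>n=1..N. w n * L (u s) n) \<le> 0"
    unfolding mass_L[OF solD(1)[OF u]] by (rule sum_nonpos)
  then show "\<exists>y. ((\<lambda>t. \<Sum>n=1..N. w n * u t n) has_real_derivative y) (at s) \<and> y \<le> 0"
    using mass_deriv[OF u] by blast
qed

lemma col_bound:
  assumes j: "1 \<le> j" and t: "0 \<le> t"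
  shows "(\<Sum>n=1..N. w n * \<bar>p t n j\<bar>) \<le> w j"
proof -
  \<comment> \<open>The range up to \<open>M\<close> also covers the support \<open>{1..j}\<close>
    of the column, so \<open>mass_le\<close> applies; the initial column is a unit vector of mass
    \<open>w j\<close>.\<close>
  define M where "M = max N j"
  have "(\<Sum>n=1..N. w n * \<bar>p t n j\<bar>) \<le> (\<Sum>n=1..M. w n * \<bar>p t n j\<bar>)"
    by (rule sum_mono2) (auto simp: M_def w_nonneg)
  also have "\<dots> = (\<Sum>n=1..M. w n * p t n j)" using col_nonneg[OF j t] by simp
  also have "\<dots> \<le> (\<Sum>n=1..M. w n * p 0 n j)"
    by (rule mass_le[OF sol_mono[OF sol_col[OF j]] _ t])
      (simp_all add: M_def col_0 unit_seq_def)
  also have "\<dots> = (\<Sum>n\<in>{1..M}. if n = j then w j else 0)"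
    by (rule sum.cong) (auto simp: col_0 unit_seq_def)
  also have "\<dots> = w j" using j by (simp add: M_def)
  finally show ?thesis .
qed

section \<open>The contraction semigroup on \<open>ell1 w\<close>\<close>

lemma S_ell1: "0 \<le> t \<Longrightarrow> f \<in> ell1 w \<Longrightarrow> S t f \<in> ell1 w"
  and S_contraction: "0 \<le> t \<Longrightarrow> f \<in> ell1 w \<Longrightarrow> wnorm w (S t f) \<le> wnorm w f"
  using mat_op_bound(2,3)[of "p t"] col_bound[of _ t] unfolding flow_def by blast+

lemma S_diff:
  "0 \<le> t \<Longrightarrow> f \<in> ell1 w \<Longrightarrow> g \<in> ell1 w \<Longrightarrow> S t (\<lambda>n. f n - g n) = (\<lambda>n. S t f n - S t g n)"
  unfolding flow_def by (rule mat_op_linear(3)[OF col_bound])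

lemma S_diff_le:
  assumes "0 \<le> t" "f \<in> ell1 w" "g \<in> ell1 w"
  shows "wnorm w (\<lambda>n. S t f n - S t g n) \<le> wnorm w (\<lambda>n. f n - g n)"
  using S_contraction[OF assms(1) ell1_diff(1)[OF assms(2,3)]] S_diff[OF assms] by simp

lemma S_nonneg:
  assumes t: "0 \<le> t" and f: "f \<in> ell1 w" "\<And>n. 0 \<le> f n"
  shows "0 \<le> S t f n"
  using mat_op_bound(1)[OF col_bound[OF _ t] f(1), of n] f(2) col_nonneg[OF _ t]
  by (auto simp: flow_def mat_op_def intro!: suminf_nonneg)

text \<open>The law holds on finitely supported sequences; density of truncations and contractivity
  of the three operators carry it over.\<close>

lemma S_add:
  assumes s: "0 \<le> s" and t: "0 \<le> t" and f: "f \<in> ell1 w"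
  shows "S (s + t) f = S s (S t f)"
proof -
  let ?d = "\<lambda>n. S (s + t) f n - S s (S t f) n"
  have d: "?d \<in> ell1 w" using s t f by (intro ell1_diff S_ell1) auto
  \<comment> \<open>The shape \<open>0 + e\<close> is the one that \<open>field_le_epsilon\<close>
    expects.\<close>
  have "wnorm w ?d \<le> 0 + e" if "0 < e" for e
  proof -
    from that have "0 < e / 2" by simp
    from trunc_approx[OF f this] obtain N where N: "trunc N f \<in> supp_upto N" "trunc N f \<in> ell1 w"
      "wnorm w (\<lambda>n. trunc N f n - f n) < e / 2" .
    let ?g = "trunc N f"
    have "wnorm w ?d \<le> wnorm w (\<lambda>n. S (s + t) f n - S (s + t) ?g n) +
      wnorm w (\<lambda>n. S s (S t ?g) n - S s (S t f) n)"
      using wnorm_triangle[of "S (s + t) f" "S (s + t) ?g" "S s (S t f)"] S_supp_add[OF N(1) s t]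
        s t f N(2) S_ell1 by simp
    also have "wnorm w (\<lambda>n. S (s + t) f n - S (s + t) ?g n) \<le> wnorm w (\<lambda>n. f n - ?g n)"
      using s t f N(2) by (intro S_diff_le) auto
    also have "wnorm w (\<lambda>n. S s (S t ?g) n - S s (S t f) n) \<le> wnorm w (\<lambda>n. S t ?g n - S t f n)"
      using s t f N(2) by (intro S_diff_le S_ell1) auto
    also have "\<dots> \<le> wnorm w (\<lambda>n. ?g n - f n)" using t f N(2) by (intro S_diff_le) auto
    finally show ?thesis using N(3) wnorm_commute[of f ?g] by simp
  qed
  then have "wnorm w ?d \<le> 0" by (rule field_le_epsilon)
  from wnorm_eq_0[OF d this] show ?thesis by (auto simp: fun_eq_iff)
qed

lemma S_continuous_supp:
  assumes f: "f \<in> supp_upto N"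
  shows "((\<lambda>t. wnorm w (\<lambda>n. S t f n - f n)) \<longlongrightarrow> 0) (at_right 0)"
proof -
  have "((\<lambda>t. S t f n) \<longlongrightarrow> S 0 f n) (at_right 0)" for n
    using DERIV_isCont[OF solD(2)[OF sol_S[OF f], of n 0]]
    by (simp add: isCont_def filterlim_at_split)
  moreover have "S 0 f = f" using f by (intro S_0) (simp add: supp_upto_def)
  ultimately have lim: "((\<lambda>t. S t f n) \<longlongrightarrow> f n) (at_right 0)" for n by metis
  have "((\<lambda>t. \<Sum>n=1..N. w n * \<bar>S t f n - f n\<bar>) \<longlongrightarrow> (\<Sum>n=1..N. w n * \<bar>f n - f n\<bar>)) (at_right 0)"
    by (intro tendsto_intros lim)
  moreover have "wnorm w (\<lambda>n. S t f n - f n) = (\<Sum>n=1..N. w n * \<bar>S t f n - f n\<bar>)" for t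
    by (rule supp_ell1(2)[OF supp_upto_diff[OF solD(1)[OF sol_S[OF f]] f]])
  ultimately show ?thesis by simp
qed

text \<open>A three-term estimate: contractivity makes the two truncation errors uniform in
  \<open>t\<close>.\<close>

lemma S_continuous:
  assumes f: "f \<in> ell1 w"
  shows "((\<lambda>t. wnorm w (\<lambda>n. S t f n - f n)) \<longlongrightarrow> 0) (at_right 0)"
proof (rule tendstoI)
  fix e :: real assume "0 < e"
  then have e: "0 < e / 3" by simp
  from trunc_approx[OF f this] obtain N where N: "trunc N f \<in> supp_upto N" "trunc N f \<in> ell1 w"
    "wnorm w (\<lambda>n. trunc N f n - f n) < e / 3" .
  let ?g = "trunc N f"
  have "eventually (\<lambda>t. wnorm w (\<lambda>n. S t ?g n - ?g n) < e / 3) (at_right 0)"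
    using order_tendstoD(2)[OF S_continuous_supp[OF N(1)] e] .
  then show "eventually (\<lambda>t. dist (wnorm w (\<lambda>n. S t f n - f n)) 0 < e) (at_right 0)"
    using eventually_at_right_less[of "0::real"]
  proof eventually_elim
    case (elim t)
    then have t: "0 \<le> t" by simp
    have "wnorm w (\<lambda>n. S t f n - f n) \<le>
      wnorm w (\<lambda>n. S t f n - S t ?g n) + wnorm w (\<lambda>n. S t ?g n - f n)"
      by (intro wnorm_triangle S_ell1 t f N(2))
    also have "wnorm w (\<lambda>n. S t f n - S t ?g n) \<le> wnorm w (\<lambda>n. f n - ?g n)"
      by (intro S_diff_le t f N(2))
    also have "wnorm w (\<lambda>n. S t ?g n - f n) \<le>
      wnorm w (\<lambda>n. S t ?g n - ?g n) + wnorm w (\<lambda>n. ?g n - f n)"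
      by (intro wnorm_triangle S_ell1 t f N(2))
    finally have "wnorm w (\<lambda>n. S t f n - f n) < e"
      using elim(1) N(3) wnorm_commute[of f ?g] by simp
    moreover have "0 \<le> wnorm w (\<lambda>n. S t f n - f n)" by (intro wnorm_nonneg ell1_diff S_ell1 t f)
    ultimately show ?case by (simp add: dist_real_def)
  qed
qed

lemma C0_semigroup_S: "C0_semigroup w S"
  unfolding C0_semigroup_def
proof (intro conjI allI impI ballI)
  show "bounded_linear_on_ell1 w (S t)" if "0 \<le> t" for t
    unfolding flow_def by (rule mat_op_bounded_linear) (rule col_bound[OF _ that])
qed (auto intro: S_0 ell1_zero S_add S_continuous)

lemma substochastic_S: "substochastic_semigroup w S"
  unfolding substochastic_semigroup_def positive_semigroup_def pos_cone_def
  using C0_semigroup_S S_ell1 S_nonneg S_contraction by auto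

section \<open>Identification of the generator\<close>

lemma core_ell1: "finite_core a b \<subseteq> ell1 w \<times> ell1 w"
  using supp_ell1(1) L_closed by (fastforce simp: finite_core_def)

text \<open>The mean value theorem applied to \<open>s \<mapsto> \<Sum>n. w n * \<sigma> n * (S s u n - u n - s * L u n)\<close>,
  where \<open>\<sigma> n\<close> is the sign of the \<open>n\<close>-th component at \<open>s = h\<close>.\<close>

lemma S_difference_quotient:
  assumes u: "u \<in> supp_upto N" and h: "0 \<le> h"
    and e: "\<And>s. 0 \<le> s \<Longrightarrow> s \<le> h \<Longrightarrow> wnorm w (\<lambda>n. S s (L u) n - L u n) \<le> e"
  shows "wnorm w (\<lambda>n. S h u n - u n - h * L u n) \<le> h * e"
proof -
  define \<sigma> where "\<sigma> n = sgn (S h u n - u n - h * L u n)" for n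
  define \<phi> where "\<phi> s = (\<Sum>n=1..N. w n * (\<sigma> n * (S s u n - u n - s * L u n))) - s * e" for s
  note su = sol_S[OF u] and Lu = L_closed[OF u]
  have "\<phi> h \<le> \<phi> 0"
  proof (rule DERIV_nonpos_imp_nonincreasing[OF h])
    fix s assume s: "0 \<le> s" "s \<le> h"
    have d: "((\<lambda>s. S s u n - u n - s * L u n) has_real_derivative L (S s u) n - L u n) (at s)" for n
      by (rule derivative_eq_intros solD(2)[OF su] refl)+ simp
    have e': "((\<lambda>s. s * e) has_real_derivative e) (at s)"
      by (rule derivative_eq_intros refl)+ simp
    have "(\<phi> has_real_derivative (\<Sum>n=1..N. w n * (\<sigma> n * (L (S s u) n - L u n))) - e) (at s)"
      unfolding \<phi>_def by (intro DERIV_diff DERIV_sum DERIV_cmult d e')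
    \<comment> \<open>The commutation \<open>L (S s u) = S s (L u)\<close> turns the derivative into
      the quantity that \<open>e\<close> bounds.\<close>
    moreover have "(\<Sum>n=1..N. w n * (\<sigma> n * (L (S s u) n - L u n))) \<le>
      (\<Sum>n=1..N. w n * \<bar>S s (L u) n - L u n\<bar>)"
      unfolding S_L[OF u s(1)]
      by (intro sum_mono mult_left_mono) (auto simp: \<sigma>_def sgn_if w_nonneg)
    then have "(\<Sum>n=1..N. w n * (\<sigma> n * (L (S s u) n - L u n))) - e \<le> 0"
      using e[OF s] supp_ell1(2)[OF supp_upto_diff[OF solD(1)[OF sol_S[OF Lu]] Lu], of s] by simp
    ultimately show "\<exists>y. (\<phi> has_real_derivative y) (at s) \<and> y \<le> 0" by blast
  qed
  also have "\<phi> 0 = 0" using S_0[of u] u by (simp add: \<phi>_def supp_upto_def)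
  finally have "(\<Sum>n=1..N. w n * (\<sigma> n * (S h u n - u n - h * L u n))) \<le> h * e"
    by (simp add: \<phi>_def)
  moreover have "(\<lambda>n. S h u n - u n - h * L u n) \<in> supp_upto N"
    using solD(1)[OF su] u Lu by (auto simp: supp_upto_def)
  ultimately show ?thesis
    by (simp add: supp_ell1(2) \<sigma>_def abs_sgn mult.commute[of "sgn _"])
qed

text \<open>Supplies the pair to which dissipativity is applied when an element of the core is
  compared with one of the generator.\<close>

lemma generator_linear_diff:
  assumes "(f, g) \<in> generator w S" "(u, v) \<in> generator w S"
  shows "(\<lambda>n. f n - u n, \<lambda>n. g n - v n) \<in> generator w S"
proof -
  have m: "f \<in> ell1 w" "g \<in> ell1 w" "u \<in> ell1 w" "v \<in> ell1 w"
    using assms by (auto simp: generator_def)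
  let ?q = "\<lambda>f g h n. (S h f n - f n) / h - g n"
  have q: "?q x y h \<in> ell1 w" if "x \<in> ell1 w" "y \<in> ell1 w" "0 \<le> h" for x y h
    using ell1_diff(1)[OF ell1_scale(1)[OF ell1_diff(1)[OF S_ell1[OF that(3,1)] that(1)], of "1 / h"] that(2)]
    by simp
  have l: "((\<lambda>h. wnorm w (?q f g h) + wnorm w (?q u v h)) \<longlongrightarrow> 0) (at_right 0)"
    using assms unfolding generator_def by (auto intro!: tendsto_add_zero)
  have "((\<lambda>h. wnorm w (?q (\<lambda>n. f n - u n) (\<lambda>n. g n - v n) h)) \<longlongrightarrow> 0) (at_right 0)"
  proof (rule tendsto_sandwich[OF _ _ tendsto_const l])
    show "eventually (\<lambda>h. 0 \<le> wnorm w (?q (\<lambda>n. f n - u n) (\<lambda>n. g n - v n) h)) (at_right 0)"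
      using eventually_at_right_less[of "0::real"]
      by eventually_elim (intro wnorm_nonneg q ell1_diff(1) m, simp)
    show "eventually (\<lambda>h. wnorm w (?q (\<lambda>n. f n - u n) (\<lambda>n. g n - v n) h) \<le>
      wnorm w (?q f g h) + wnorm w (?q u v h)) (at_right 0)"
      using eventually_at_right_less[of "0::real"]
    proof eventually_elim
      case (elim h)
      have "?q (\<lambda>n. f n - u n) (\<lambda>n. g n - v n) h = (\<lambda>n. ?q f g h n - ?q u v h n)"
        using elim m S_diff[of h f u]
        by (simp add: fun_eq_iff diff_divide_distrib)
      then show ?case using ell1_diff(2)[OF q q, of f g h u v h] elim m by simp
    qed
  qed
  then show ?thesis using m by (simp add: generator_def ell1_diff)
qed

text \<open>Write \<open>(1 + h) f = S h f + h (f - g) - h q\<close>, where \<open>q\<close> is the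
  error of the difference quotient. Contractivity of \<open>S h\<close> lets one copy of
  \<open>wnorm w f\<close> cancel; dividing by \<open>h\<close> and letting \<open>h\<close> tend to
  0 removes \<open>q\<close>.\<close>

lemma generator_dissipative:
  assumes "(f, g) \<in> generator w S"
  shows "wnorm w f \<le> wnorm w (\<lambda>n. f n - g n)"
proof -
  have m: "f \<in> ell1 w" "g \<in> ell1 w" using assms by (auto simp: generator_def)
  let ?q = "\<lambda>h n. (S h f n - f n) / h - g n"
  have l: "((\<lambda>h. wnorm w (\<lambda>n. f n - g n) + wnorm w (?q h)) \<longlongrightarrow> wnorm w (\<lambda>n. f n - g n) + 0) (at_right 0)"
    using assms by (intro tendsto_add tendsto_const) (simp add: generator_def)
  have "eventually (\<lambda>h. wnorm w f \<le> wnorm w (\<lambda>n. f n - g n) + wnorm w (?q h)) (at_right 0)"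
    using eventually_at_right_less[of "0::real"]
  proof eventually_elim
    case (elim h)
    then have h: "0 \<le> h" by simp
    let ?D = "\<lambda>n. f n - g n"
    have q: "?q h \<in> ell1 w"
      using ell1_diff(1)[OF ell1_scale(1)[OF ell1_diff(1)[OF S_ell1[OF h m(1)] m(1)], of "1 / h"] m(2)]
      by simp
    have D: "?D \<in> ell1 w" using m by (rule ell1_diff)
    have "(\<lambda>n. (1 + h) * f n) = (\<lambda>n. S h f n + (h * ?D n - h * ?q h n))"
      using elim by (simp add: fun_eq_iff field_simps)
    then have "(1 + h) * wnorm w f = wnorm w (\<lambda>n. S h f n + (h * ?D n - h * ?q h n))"
      using ell1_scale(2)[OF m(1), of "1 + h"] h by simp
    also have "\<dots> \<le> wnorm w (S h f) + wnorm w (\<lambda>n. h * ?D n - h * ?q h n)"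
      by (intro ell1_add(2) ell1_diff(1) ell1_scale(1) S_ell1 h m q)
    also have "wnorm w (\<lambda>n. h * ?D n - h * ?q h n) \<le> wnorm w (\<lambda>n. h * ?D n) + wnorm w (\<lambda>n. h * ?q h n)"
      by (intro ell1_diff ell1_scale(1) m q)
    also have "\<dots> = h * (wnorm w ?D + wnorm w (?q h))"
      using ell1_scale(2)[OF D, of h] ell1_scale(2)[OF q, of h] h by (simp add: distrib_left)
    finally have "(1 + h) * wnorm w f \<le> wnorm w f + h * (wnorm w ?D + wnorm w (?q h))"
      using S_contraction[OF h m(1)] by simp
    then have "h * wnorm w f \<le> h * (wnorm w ?D + wnorm w (?q h))" by (simp add: distrib_right)
    then show ?case using elim by simp
  qed
  from tendsto_lowerbound[OF l this] show ?thesis by simp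
qed

text \<open>The bound of \<open>S_difference_quotient\<close> involves only the continuity of the
  orbit of \<open>L u\<close>, so it survives graph limits: if \<open>S s g\<close> stays within
  \<open>e / 2\<close> of \<open>g\<close> for \<open>s \<le> h\<close>, then
  \<open>S h f - f - h g\<close> has norm at most \<open>h * (e / 2)\<close>.\<close>

lemma closure_core_generator: "op_closure w (finite_core a b) \<subseteq> generator w S"
proof clarify
  fix f g assume fg: "(f, g) \<in> op_closure w (finite_core a b)"
  then have m: "f \<in> ell1 w" "g \<in> ell1 w" by (auto simp: op_closure_def)
  have "((\<lambda>h. wnorm w (\<lambda>n. (S h f n - f n) / h - g n)) \<longlongrightarrow> 0) (at_right 0)"
  proof (rule tendstoI)
    fix e :: real assume "0 < e"
    then have e: "0 < e / 2" by simp
    from order_tendstoD(2)[OF S_continuous[OF m(2)] e]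
    obtain d where d: "d > 0" "\<And>s. 0 < s \<Longrightarrow> s < d \<Longrightarrow> wnorm w (\<lambda>n. S s g n - g n) < e / 2"
      unfolding eventually_at_right_field by blast
    have "dist (wnorm w (\<lambda>n. (S h f n - f n) / h - g n)) 0 < e" if h: "0 < h" "h < d" for h
    proof -
      have h0: "0 \<le> h" using h by simp
      let ?X = "\<lambda>f g n. S h f n - f n - h * g n"
      have X: "?X x y \<in> ell1 w" if "x \<in> ell1 w" "y \<in> ell1 w" for x y
        by (intro ell1_diff(1) ell1_scale(1) S_ell1 that h0)
      \<comment> \<open>Here \<open>h\<close> is fixed while the approximant improves, so
        \<open>\<epsilon>\<close> can be sent to 0 before dividing by \<open>h\<close>.\<close>
      have "wnorm w (?X f g) \<le> h * (e / 2) + \<epsilon>" if "0 < \<epsilon>" for \<epsilon>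
      proof -
        \<comment> \<open>Passing from \<open>L u\<close> to \<open>g\<close> in the orbit bound
          costs \<open>2 * h * \<eta>\<close>, and passing from \<open>(u, L u)\<close> to
          \<open>(f, g)\<close> in \<open>?X\<close> costs \<open>(2 + h) * \<eta>\<close>.\<close>
        define \<eta> where "\<eta> = \<epsilon> / (3 * h + 2)"
        have "0 < \<eta>" using that h by (simp add: \<eta>_def)
        then obtain u N where u: "u \<in> supp_upto N" "wnorm w (\<lambda>n. u n - f n) < \<eta>"
          "wnorm w (\<lambda>n. L u n - g n) < \<eta>"
          using fg unfolding op_closure_iff[OF core_ell1] by (force simp: finite_core_def)
        have ue: "u \<in> ell1 w" "L u \<in> ell1 w" using supp_ell1(1) L_closed u(1) by blast+
        have "wnorm w (\<lambda>n. S s (L u) n - L u n) \<le> e / 2 + 2 * \<eta>" if s: "0 \<le> s" "s \<le> h" for s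
        proof -
          have "wnorm w (\<lambda>n. S s g n - g n) \<le> e / 2"
          \<comment> \<open>The right-hand limit gives no information at \<open>s = 0\<close>
            itself.\<close>
          proof (cases "s = 0")
            case True
            then show ?thesis using S_0[of g, OF ell1_zero[OF m(2)]] e by (simp add: wnorm_def)
          next
            case False
            then show ?thesis using d(2)[of s] s h by simp
          qed
          moreover have "wnorm w (\<lambda>n. S s (L u) n - L u n) \<le>
            wnorm w (\<lambda>n. S s (L u) n - S s g n) + wnorm w (\<lambda>n. S s g n - L u n)"
            by (intro wnorm_triangle S_ell1 s ue m)
          moreover have "wnorm w (\<lambda>n. S s g n - L u n) \<le>
            wnorm w (\<lambda>n. S s g n - g n) + wnorm w (\<lambda>n. g n - L u n)"
            by (intro wnorm_triangle S_ell1 s ue m)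
          moreover have "wnorm w (\<lambda>n. S s (L u) n - S s g n) \<le> wnorm w (\<lambda>n. L u n - g n)"
            by (intro S_diff_le s ue m)
          ultimately show ?thesis using u(3) wnorm_commute[of "L u" g] by simp
        qed
        from S_difference_quotient[OF u(1) h0 this]
        have "wnorm w (?X u (L u)) \<le> h * (e / 2 + 2 * \<eta>)" .
        moreover have "wnorm w (?X f g) \<le> wnorm w (\<lambda>n. ?X f g n - ?X u (L u) n) + wnorm w (?X u (L u))"
          using ell1_add(2)[OF ell1_diff(1)[OF X X] X, OF m ue ue] by simp
        moreover have "wnorm w (\<lambda>n. ?X f g n - ?X u (L u) n) \<le>
          wnorm w (\<lambda>n. f n - u n) + (wnorm w (\<lambda>n. f n - u n) + h * wnorm w (\<lambda>n. g n - L u n))"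
        proof -
          have "(\<lambda>n. ?X f g n - ?X u (L u) n) =
            (\<lambda>n. (S h f n - S h u n) - ((f n - u n) + h * (g n - L u n)))"
            by (simp add: fun_eq_iff algebra_simps)
          then have "wnorm w (\<lambda>n. ?X f g n - ?X u (L u) n) \<le> wnorm w (\<lambda>n. S h f n - S h u n) +
            wnorm w (\<lambda>n. (f n - u n) + h * (g n - L u n))"
            using ell1_diff(2)[OF ell1_diff(1)[OF S_ell1 S_ell1]
              ell1_add(1)[OF ell1_diff(1) ell1_scale(1)[OF ell1_diff(1)]],
              OF h0 m(1) h0 ue(1) m(1) ue(1) m(2) ue(2), of h] by simp
          moreover have "wnorm w (\<lambda>n. S h f n - S h u n) \<le> wnorm w (\<lambda>n. f n - u n)"
            by (intro S_diff_le h0 m ue)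
          moreover have "wnorm w (\<lambda>n. (f n - u n) + h * (g n - L u n)) \<le>
            wnorm w (\<lambda>n. f n - u n) + h * wnorm w (\<lambda>n. g n - L u n)"
            using ell1_add(2)[OF ell1_diff(1) ell1_scale(1)[OF ell1_diff(1)],
              OF m(1) ue(1) m(2) ue(2), of h] ell1_scale(2)[OF ell1_diff(1)[OF m(2) ue(2)], of h] h0
            by simp
          ultimately show ?thesis by simp
        qed
        moreover have "h * wnorm w (\<lambda>n. g n - L u n) \<le> h * \<eta>"
          using u(3) wnorm_commute[of g "L u"] h0 by (intro mult_left_mono) auto
        ultimately have "wnorm w (?X f g) \<le> h * (e / 2) + (3 * h + 2) * \<eta>"
          using u(2) wnorm_commute[of f u] by (simp add: algebra_simps)
        also have "(3 * h + 2) * \<eta> = \<epsilon>" using h by (simp add: \<eta>_def)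
        finally show ?thesis .
      qed
      then have "wnorm w (?X f g) \<le> h * (e / 2)" by (rule field_le_epsilon)
      then have le: "wnorm w (?X f g) / h \<le> e / 2" using h by (simp add: pos_divide_le_eq mult.commute)
      have eq: "(\<lambda>n. (S h f n - f n) / h - g n) = (\<lambda>n. (1 / h) * ?X f g n)"
        using h by (simp add: fun_eq_iff field_simps)
      have "wnorm w (\<lambda>n. (S h f n - f n) / h - g n) = wnorm w (?X f g) / h"
        unfolding eq using ell1_scale(2)[OF X[OF m], of "1 / h"] h by simp
      then have "wnorm w (\<lambda>n. (S h f n - f n) / h - g n) \<le> e / 2" using le by simp
      moreover have "0 \<le> wnorm w (\<lambda>n. (S h f n - f n) / h - g n)"
        unfolding eq by (intro wnorm_nonneg ell1_scale(1) X m)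
      ultimately show ?thesis using \<open>0 < e\<close> by (simp add: dist_real_def)
    qed
    then show "eventually (\<lambda>h. dist (wnorm w (\<lambda>n. (S h f n - f n) / h - g n)) 0 < e) (at_right 0)"
      unfolding eventually_at_right_field using d(1) by blast
  qed
  then show "(f, g) \<in> generator w S" using m by (simp add: generator_def)
qed

lemma subset_closure: "T \<subseteq> ell1 w \<times> ell1 w \<Longrightarrow> T \<subseteq> op_closure w T"
proof clarify
  fix f g assume T: "T \<subseteq> ell1 w \<times> ell1 w" and fg: "(f, g) \<in> T"
  have "wnorm w (\<lambda>n. x n - x n) = 0" for x :: seq by (simp add: wnorm_def)
  then show "(f, g) \<in> op_closure w T"
    unfolding op_closure_iff[OF T] using T fg by (auto intro!: bexI[OF _ fg])
qed

text \<open>Solve \<open>u - L u = trunc N (f - g)\<close>. Dissipativity of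
  \<open>(u - f, L u - g)\<close> bounds the error in \<open>u\<close> by the truncation error, and
  the error in \<open>L u\<close> is then at most twice the truncation error.\<close>

lemma generator_closure_core: "generator w S \<subseteq> op_closure w (finite_core a b)"
proof clarify
  fix f g assume fg: "(f, g) \<in> generator w S"
  then have m: "f \<in> ell1 w" "g \<in> ell1 w" by (auto simp: generator_def)
  let ?h = "\<lambda>n. f n - g n"
  have h: "?h \<in> ell1 w" using m by (rule ell1_diff)
  have "\<exists>(u, v)\<in>finite_core a b. wnorm w (\<lambda>n. u n - f n) < e \<and> wnorm w (\<lambda>n. v n - g n) < e"
    if "0 < e" for e
  proof -
    from that have "0 < e / 2" by simp
    from trunc_approx[OF h this] obtain N where N: "trunc N ?h \<in> supp_upto N"
      "trunc N ?h \<in> ell1 w" "wnorm w (\<lambda>n. trunc N ?h n - ?h n) < e / 2" .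
    from one_minus_L_surj[OF N(1)] obtain u where u: "u \<in> supp_upto N"
      "(\<lambda>n. u n - L u n) = trunc N ?h" by blast
    have uc: "(u, L u) \<in> finite_core a b" using u(1) by (auto simp: finite_core_def)
    then have ue: "u \<in> ell1 w" "L u \<in> ell1 w" using core_ell1 by auto
    have "(u, L u) \<in> generator w S"
      using uc subset_closure[OF core_ell1] closure_core_generator by blast
    from generator_dissipative[OF generator_linear_diff[OF this fg]]
    have "wnorm w (\<lambda>n. u n - f n) \<le> wnorm w (\<lambda>n. trunc N ?h n - ?h n)"
      by (simp add: u(2)[symmetric] algebra_simps)
    moreover have "wnorm w (\<lambda>n. L u n - g n) \<le>
      wnorm w (\<lambda>n. u n - f n) + wnorm w (\<lambda>n. trunc N ?h n - ?h n)"
      using ell1_diff(2)[OF ell1_diff(1)[OF ue(1) m(1)] ell1_diff(1)[OF N(2) h]]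
      by (simp add: u(2)[symmetric] algebra_simps)
    ultimately show ?thesis using N(3) that by (intro bexI[OF _ uc]) simp
  qed
  then show "(f, g) \<in> op_closure w (finite_core a b)"
    unfolding op_closure_iff[OF core_ell1] using m by blast
qed

lemma core_op_plus: "finite_core a b \<subseteq> op_plus (op_A w a) (op_B w a b)"
proof (clarsimp simp: finite_core_def)
  fix u N assume u: "u \<in> supp_upto N"
  have au: "(\<lambda>n. a n * u n) \<in> supp_upto N" using u by (simp add: supp_upto_def)
  have "B_map a b u = (\<lambda>n. L u n + a n * u n)" by (simp add: AB_map_def)
  then have Bu: "B_map a b u \<in> supp_upto N"
    using L_closed[OF u] au by (simp add: supp_upto_def)
  have "(u, \<lambda>n. - a n * u n) \<in> op_A w a"
    using supp_ell1(1)[OF u] supp_ell1(1)[OF au] by (auto simp: op_A_def)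
  moreover have "(u, B_map a b u) \<in> op_B w a b"
    using supp_ell1(1)[OF u] supp_ell1(1)[OF Bu] B_supp(1)[OF u] by (auto simp: op_B_def)
  ultimately show "(u, L u) \<in> op_plus (op_A w a) (op_B w a b)"
    unfolding op_plus_def AB_map_def mem_Collect_eq
    by (intro exI[of _ u] exI[of _ "\<lambda>n. - a n * u n"] exI[of _ "B_map a b u"]) simp
qed

text \<open>Puts \<open>b\<close> itself under the column-sum test, so that \<open>B\<close> is
  dominated by \<open>A\<close>: the norm of \<open>b\<close> applied to \<open>a f\<close> is at
  most that of \<open>a f\<close>.\<close>

lemma b_bound: "1 \<le> j \<Longrightarrow> (\<Sum>n=1..N. w n * \<bar>b n j\<bar>) \<le> w j"
proof -
  assume j: "1 \<le> j"
  have "(\<Sum>n=1..N. w n * \<bar>b n j\<bar>) \<le> (\<Sum>n=1..max N j. w n * \<bar>b n j\<bar>)"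
    by (rule sum_mono2) (auto simp: w_nonneg)
  also have "\<dots> = (\<Sum>n=1..max N j. w n * b n j)"
    by (rule sum.cong) (use j b_nonneg in auto)
  also have "\<dots> = (\<Sum>n=1..j-1. w n * b n j)" by (rule column_sum) (use j in auto)
  also have "\<dots> \<le> w j" by (rule subinvariant[OF j])
  finally show ?thesis .
qed

lemma B_map_mat_op:
  assumes "f 0 = 0" "(\<lambda>n. a n * f n) \<in> ell1 w"
  shows "B_map a b f = mat_op b (\<lambda>n. a n * f n)"
proof
  fix n
  show "B_map a b f n = mat_op b (\<lambda>n. a n * f n) n"
  proof (cases "n = 0")
    case True then show ?thesis by (simp add: B_map_def mat_op_def)
  next
    case False
    then have n: "n \<ge> 1" by simp
    have "summable (\<lambda>j. b n (Suc j) * (a (Suc j) * f (Suc j)))"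
      using mat_op_bound(1)[OF b_bound assms(2) n] by simp
    then show ?thesis using b_zero[OF n] n by (intro B_map_shift(2)) simp_all
  qed
qed

text \<open>Truncating \<open>f\<close> also truncates \<open>a f\<close>, and \<open>B\<close> is
  dominated by \<open>a f\<close>; hence truncations converge in the graph norm.\<close>

lemma op_plus_closure_core:
  "op_plus (op_A w a) (op_B w a b) \<subseteq> op_closure w (finite_core a b)"
proof clarify
  fix f g assume "(f, g) \<in> op_plus (op_A w a) (op_B w a b)"
  then have m: "f \<in> ell1 w" "(\<lambda>n. a n * f n) \<in> ell1 w" and Bf: "B_map a b f \<in> ell1 w"
    and g: "g = (\<lambda>n. - a n * f n + B_map a b f n)"
    by (auto simp: op_plus_def op_A_def op_B_def)
  let ?F = "\<lambda>n. a n * f n"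
  have ge: "g \<in> ell1 w" unfolding g using ell1_diff(1)[OF Bf m(2)] by simp
  have "\<exists>(u, v)\<in>finite_core a b. wnorm w (\<lambda>n. u n - f n) < e \<and> wnorm w (\<lambda>n. v n - g n) < e"
    if "0 < e" for e
  proof -
    from that have e: "0 < e / 2" by simp
    \<comment> \<open>The error in \<open>a f\<close> enters twice, once through \<open>A\<close>
      and once through \<open>b\<close>, hence \<open>e / 2\<close>.\<close>
    have "eventually (\<lambda>N. wnorm w (\<lambda>n. trunc N f n - f n) < e \<and>
      wnorm w (\<lambda>n. trunc N ?F n - ?F n) < e / 2) sequentially"
      by (intro eventually_conj order_tendstoD(2)[OF trunc_tendsto] m that e)
    then obtain N where N: "wnorm w (\<lambda>n. trunc N f n - f n) < e"
      "wnorm w (\<lambda>n. trunc N ?F n - ?F n) < e / 2"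
      by (auto simp: eventually_sequentially)
    let ?u = "trunc N f" and ?U = "trunc N ?F"
    have u: "?u \<in> supp_upto N" "?U \<in> supp_upto N"
      by (rule trunc_supp, rule ell1_zero, rule m)+
    note Ue = supp_ell1(1)[OF u(2)]
    have au: "(\<lambda>n. a n * ?u n) = ?U" by (auto simp: trunc_def)
    have "B_map a b ?u = mat_op b ?U"
      using B_map_mat_op[of ?u] supp_uptoD[OF u(1), of 0] Ue unfolding au by simp
    moreover have "B_map a b f = mat_op b ?F"
      by (rule B_map_mat_op[OF ell1_zero[OF m(1)] m(2)])
    moreover have "a n * ?u n = ?U n" for n using fun_cong[OF au] .
    ultimately have "(\<lambda>n. L ?u n - g n) = (\<lambda>n. mat_op b (\<lambda>n. ?U n - ?F n) n - (?U n - ?F n))"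
      unfolding g AB_map_def by (simp add: mat_op_linear(3)[OF b_bound Ue m(2)] algebra_simps)
    then have "wnorm w (\<lambda>n. L ?u n - g n) \<le>
      wnorm w (mat_op b (\<lambda>n. ?U n - ?F n)) + wnorm w (\<lambda>n. ?U n - ?F n)"
      using ell1_diff(2)[OF mat_op_bound(2)[OF b_bound ell1_diff(1)[OF Ue m(2)]] ell1_diff(1)[OF Ue m(2)]]
      by simp
    also have "wnorm w (mat_op b (\<lambda>n. ?U n - ?F n)) \<le> wnorm w (\<lambda>n. ?U n - ?F n)"
      by (rule mat_op_bound(3)[OF b_bound ell1_diff(1)[OF Ue m(2)]])
    finally have "wnorm w (\<lambda>n. L ?u n - g n) < e" using N(2) by simp
    moreover have "(?u, L ?u) \<in> finite_core a b" using u(1) by (auto simp: finite_core_def)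
    ultimately show ?thesis using N(1) by blast
  qed
  then show "(f, g) \<in> op_closure w (finite_core a b)"
    unfolding op_closure_iff[OF core_ell1] using m(1) ge by blast
qed

text \<open>\<open>A + B\<close> lies between the core and the closure of the core, so both have the
  same closure.\<close>

lemma generator_S: "generator w S = op_G w a b"
proof -
  have p: "op_plus (op_A w a) (op_B w a b) \<subseteq> ell1 w \<times> ell1 w"
    using op_plus_closure_core by (auto simp: op_closure_def)
  have "op_closure w (finite_core a b) = op_closure w (op_plus (op_A w a) (op_B w a b))"
    using op_closure_sub[OF op_plus_closure_core core_ell1]
      op_closure_sub[OF subset_trans[OF core_op_plus subset_closure[OF p]] p] by blast
  then show ?thesis
    using closure_core_generator generator_closure_core by (auto simp: op_G_def)
qed

section \<open>Conservation of mass\<close>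

text \<open>On finite supports every term of \<open>mass_L\<close> vanishes, so mass is constant;
  for nonnegative sequences it equals the norm. Truncation and continuity of the norm extend this to
  the whole cone.\<close>

lemma stochastic_S:
  assumes conservative: "\<And>j. 1 \<le> j \<Longrightarrow> a j * ((\<Sum>n=1..j-1. w n * b n j) - w j) = 0"
  shows "stochastic_semigroup w S"
proof -
  have eq_supp: "wnorm w (S t f) = wnorm w f"
    if t: "0 \<le> t" and f: "f \<in> supp_upto N" "\<And>n. 0 \<le> f n" for t f N
  proof -
    note sf = sol_S[OF f(1)]
    have f0: "S 0 f = f" using f by (intro S_0) (simp add: supp_upto_def)
    have "(\<Sum>n=1..N. w n * L (S s f) n) = 0" for s
    proof -
      have "a j * S s f j * ((\<Sum>n=1..j-1. w n * b n j) - w j) = 0" if "j \<in> {1..N}" for j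
        using conservative[of j] that by auto
      then show ?thesis unfolding mass_L[OF solD(1)[OF sf]] by (rule sum.neutral[OF ballI])
    qed
    then have "((\<lambda>t. \<Sum>n=1..N. w n * S t f n) has_real_derivative 0) (at s)" for s
      using mass_deriv[OF sf, of s] by simp
    from DERIV_isconst_all[OF allI[OF this], of t 0]
    have "(\<Sum>n=1..N. w n * S t f n) = (\<Sum>n=1..N. w n * f n)" by (simp add: f0)
    moreover have "0 \<le> S t f n" for n
      by (rule S_nonneg[OF t supp_ell1(1)[OF f(1)] f(2)])
    ultimately show ?thesis
      using f(2) by (simp add: supp_ell1(2)[OF f(1)] supp_ell1(2)[OF solD(1)[OF sf]])
  qed
  have "wnorm w (S t f) = wnorm w f" if t: "0 \<le> t" and f: "f \<in> pos_cone w" for t f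
  proof -
    have f': "f \<in> ell1 w" "\<And>n. 0 \<le> f n" using f by (auto simp: pos_cone_def)
    have tr: "trunc N f \<in> supp_upto N" "trunc N f \<in> ell1 w" for N
      using trunc_supp[of f, OF ell1_zero[OF f'(1)]] supp_ell1(1) by blast+
    have a: "(\<lambda>N. wnorm w (trunc N f)) \<longlonglongrightarrow> wnorm w f"
      using wnorm_diff_abs[OF tr(2) f'(1)]
      by (intro Lim_null[THEN iffD2, OF Lim_null_comparison[OF _ trunc_tendsto[OF f'(1)]]]
        always_eventually allI) simp
    have "norm (wnorm w (S t (trunc N f)) - wnorm w (S t f)) \<le> wnorm w (\<lambda>n. trunc N f n - f n)" for N
      using wnorm_diff_abs[OF S_ell1[OF t tr(2)] S_ell1[OF t f'(1)], of N]
        S_diff_le[OF t tr(2) f'(1), of N] by simp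
    then have b: "(\<lambda>N. wnorm w (S t (trunc N f))) \<longlonglongrightarrow> wnorm w (S t f)"
      by (intro Lim_null[THEN iffD2, OF Lim_null_comparison[OF _ trunc_tendsto[OF f'(1)]]]
        always_eventually allI)
    have eq: "wnorm w (S t (trunc N f)) = wnorm w (trunc N f)" for N
      by (rule eq_supp[OF t tr(1)]) (simp add: trunc_def f'(2))
    show ?thesis by (rule LIMSEQ_unique[OF b[unfolded eq] a])
  qed
  then show ?thesis
    using substochastic_S by (auto simp: stochastic_semigroup_def substochastic_semigroup_def)
qed

end

section \<open>One flow in three weights: \<open>w\<close>, \<open>w + w c\<close> and
  \<open>real\<close>\<close>

theorem theorem3p4:
  fixes a w :: "nat \<Rightarrow> real" and b :: "nat \<Rightarrow> nat \<Rightarrow> real"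
  assumes a_nonneg: "\<forall>n\<ge>1. 0 \<le> a n"
    and b_nonneg: "\<forall>n\<ge>1. \<forall>j\<ge>1. 0 \<le> b n j"
    and b_zero: "\<forall>n\<ge>1. \<forall>j\<ge>1. j \<le> n \<longrightarrow> b n j = 0"
    and w_weight: "weight w"
    and w_ge: "\<forall>n\<ge>1. real n \<le> w n"
    and kappa: "\<exists>\<kappa>::real. 0 < \<kappa> \<and> \<kappa> \<le> 1 \<and> (\<forall>j\<ge>2. (\<Sum>n=1..j-1. w n * b n j) \<le> \<kappa> * w j)"
  shows "\<exists>S. C0_semigroup w S \<and> generator w S = op_G w a b \<and> substochastic_semigroup w S \<and>
    (\<forall>c::nat \<Rightarrow> real. (\<forall>n\<ge>1. c n \<le> c (Suc n)) \<and> (\<forall>n\<ge>1. a n \<le> c n) \<longrightarrow>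
       Domain (op_C w c) = ell1 (\<lambda>n. w n + w n * c n) \<and>
       (\<forall>t\<ge>0. \<forall>f\<in>Domain (op_C w c). S t f \<in> Domain (op_C w c))) \<and>
    (a 1 = 0 \<and> (\<forall>j\<ge>2. (\<Sum>n=1..j-1. real n * b n j) = real j) \<and> (\<forall>n\<ge>1. w n = real n) \<longrightarrow>
       generator real S = op_G real a b \<and> stochastic_semigroup real S)"
proof -
  from kappa obtain \<kappa> where \<kappa>: "0 < \<kappa>" "\<kappa> \<le> 1"
    "\<And>j. j \<ge> 2 \<Longrightarrow> (\<Sum>n=1..j-1. w n * b n j) \<le> \<kappa> * w j"
    by blast
  have w_pos: "0 < w n" if "n \<ge> 1" for n using w_weight that by (simp add: weight_def)
  \<comment> \<open>Since \<open>\<kappa> \<le> 1\<close>, the constant can be taken to be one; at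
    \<open>j = 1\<close> the sum is empty.\<close>
  have sub: "(\<Sum>n=1..j-1. w n * b n j) \<le> w j" if "1 \<le> j" for j
  proof (cases "j = 1")
    case True then show ?thesis using w_pos[of 1] by simp
  next
    case False
    then have "(\<Sum>n=1..j-1. w n * b n j) \<le> \<kappa> * w j" using that by (intro \<kappa>(3)) simp
    also have "\<dots> \<le> 1 * w j" using \<kappa>(2) w_pos[OF that] by (intro mult_right_mono) auto
    finally show ?thesis by simp
  qed
  have frag: "fragmentation a b"
    by unfold_locales (use a_nonneg b_nonneg b_zero in auto)
  interpret W: fragmentation_space w a b
    by (intro fragmentation_space.intro frag weighted.intro fragmentation_space_axioms.intro w_weight sub)
  show ?thesis
  \<comment> \<open>The witness does not depend on the weight, so the interpretations for
    \<open>w\<close>, \<open>?v\<close> and \<open>real\<close> all speak of one semigroup.\<close>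
  proof (intro exI[of _ "flow a b"] conjI allI impI ballI)
    show "C0_semigroup w (flow a b)" by (rule W.C0_semigroup_S)
    show "generator w (flow a b) = op_G w a b" by (rule W.generator_S)
    show "substochastic_semigroup w (flow a b)" by (rule W.substochastic_S)
  next
    fix c :: "nat \<Rightarrow> real"
    assume c: "(\<forall>n\<ge>1. c n \<le> c (Suc n)) \<and> (\<forall>n\<ge>1. a n \<le> c n)"
    let ?v = "\<lambda>n. w n + w n * c n"
    have c0: "0 \<le> c n" if "n \<ge> 1" for n using c a_nonneg that order_trans by blast
    have c_mono: "c n \<le> c j" if "1 \<le> n" "n \<le> j" for n j
      using that(2) by (induction rule: dec_induct) (use c that(1) order_trans in \<open>auto, force\<close>)
    have v: "weight ?v" using w_pos c0 W.w_nonneg by (simp add: weight_def add_pos_nonneg)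
    \<comment> \<open>As \<open>c\<close> is nondecreasing, \<open>1 + c n \<le> 1 + c j\<close> for
      \<open>n < j\<close>; the factor \<open>1 + c j\<close> comes out of the column sum and leaves
      the bound for \<open>w\<close>.\<close>
    have vsub: "(\<Sum>n=1..j-1. ?v n * b n j) \<le> ?v j" if j: "1 \<le> j" for j
    proof -
      have "(\<Sum>n=1..j-1. ?v n * b n j) \<le> (\<Sum>n=1..j-1. (1 + c j) * (w n * b n j))"
      proof (rule sum_mono)
        fix n assume n: "n \<in> {1..j-1}"
        then have "(1 + c n) * (w n * b n j) \<le> (1 + c j) * (w n * b n j)"
          using c_mono[of n j] b_nonneg j W.w_nonneg[of n] by (intro mult_right_mono) auto
        then show "?v n * b n j \<le> (1 + c j) * (w n * b n j)" by (simp add: algebra_simps)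
      qed
      also have "\<dots> = (1 + c j) * (\<Sum>n=1..j-1. w n * b n j)" by (simp add: sum_distrib_left)
      also have "\<dots> \<le> (1 + c j) * w j" using c0[OF j] by (intro mult_left_mono sub j) auto
      finally show ?thesis by (simp add: algebra_simps)
    qed
    interpret V: fragmentation_space ?v a b
      by (intro fragmentation_space.intro frag weighted.intro fragmentation_space_axioms.intro v vsub)
    have dom: "Domain (op_C w c) = ell1 ?v"
    proof -
      have "summable (\<lambda>n. w (Suc n) * \<bar>f (Suc n)\<bar>) \<and> summable (\<lambda>n. w (Suc n) * c (Suc n) * \<bar>f (Suc n)\<bar>)
        \<longleftrightarrow> summable (\<lambda>n. ?v (Suc n) * \<bar>f (Suc n)\<bar>)" (is "?A \<and> ?B \<longleftrightarrow> ?C") for f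
      proof
        assume "?A \<and> ?B"
        then show ?C using summable_add[of "\<lambda>n. w (Suc n) * \<bar>f (Suc n)\<bar>"] by (auto simp: distrib_right)
      next
        assume C: ?C
        \<comment> \<open>With nonnegative \<open>w\<close> and \<open>c\<close>, each of the two
          series is dominated by their sum.\<close>
        have w0: "0 \<le> w (Suc n)" "0 \<le> c (Suc n)" for n using W.w_nonneg c0 by auto
        show "?A \<and> ?B"
          by (intro conjI summable_comparison_test'[OF C, of 0])
            (auto simp: abs_mult w0 distrib_right)
      qed
      then show ?thesis by (auto simp: op_C_def ell1_def)
    qed
    then show "Domain (op_C w c) = ell1 ?v" .
    \<comment> \<open>In the space with weight \<open>?v\<close>, invariance is the statement that
      the flow maps \<open>ell1 ?v\<close> into itself.\<close>
    show "flow a b t f \<in> Domain (op_C w c)" if "0 \<le> t" "f \<in> Domain (op_C w c)" for t f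
      using V.S_ell1 that unfolding dom by blast
  next
    assume h: "a 1 = 0 \<and> (\<forall>j\<ge>2. (\<Sum>n=1..j-1. real n * b n j) = real j) \<and> (\<forall>n\<ge>1. w n = real n)"
    have cons: "(\<Sum>n=1..j-1. real n * b n j) = real j" if "2 \<le> j" for j using h that by blast
    have rsub: "(\<Sum>n=1..j-1. real n * b n j) \<le> real j" if "1 \<le> j" for j
    proof (cases "j = 1")
      case False then show ?thesis using cons[of j] that by simp
    qed simp
    \<comment> \<open>\<open>w\<close> and \<open>real\<close> are known to agree only at indices
      \<open>n \<ge> 1\<close>, so \<open>real\<close> gets its own interpretation.\<close>
    interpret R: fragmentation_space real a b
      by (intro fragmentation_space.intro frag weighted.intro fragmentation_space_axioms.intro rsub)
        (simp add: weight_def)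
    show "generator real (flow a b) = op_G real a b" by (rule R.generator_S)
    show "stochastic_semigroup real (flow a b)"
    proof (rule R.stochastic_S)
      fix j :: nat assume j: "1 \<le> j"
      \<comment> \<open>At \<open>j = 1\<close> the sum is empty and the defect is
        \<open>-1\<close>; there \<open>a 1 = 0\<close> makes the product vanish.\<close>
      show "a j * ((\<Sum>n=1..j-1. real n * b n j) - real j) = 0"
        using h cons[of j] j by (cases "j = 1") auto
    qed
  qed
qed

end
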